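(* Let $k$ be a field of characteristic zero and let $P\in M_3(k)$ be a moduli point outside of the locus $\{c=0\}$. Choose weighted projective coordinates $P=[\mathbf{d}:\mathbf{i}:\mathbf{j}:\mathbf{a}:\mathbf{b}:\mathbf{c}]$ with values in $k$, and let $\mathbf{A}_i,\mathbf{B}_{ij},\mathbf{C}_{ij}\in k$ be the corresponding values of the invariants $A_i,B_{ij},C_{ij}$. Let $\mathcal{C}_P$ be the conic in $\mathbb{P}^2$ with equation $$\sum_{1\le i,j\le 3}\mathbf{C}_{ij}x_ix_j=0 .$$ Then: (1) If $\mathcal{C}_P(k)\neq\emptyset$, there exists a model $(f,g)$ of $P$ defined over $k$. Explicitly, given a point in $\mathcal{C}_P(k)$, let $$\theta:\mathbb{P}^1\to\mathcal{C}_P,\qquad (X_0,X_1)\mapsto(\vartheta_1,\vartheta_2,\vartheta_3)$$ be the parametrization (by quadratic forms $\vartheta_i\in k[X_0,X_1]$) corresponding to that $k$-point. Then there is a nonzero factor $\beta$, depending on the choice of the parametrization $(\vartheta_i)$, such that $$f=\frac{1}{\beta\mathbf{c}}\sum_{i=1}^3\mathbf{A}_i\,\vartheta_i,\qquad g=\frac{1}{\beta^2\mathbf{c}^2}\sum_{i,j=1}^3\mathbf{B}_{ij}\,\vartheta_i\vartheta_j$$ are forms defined over $k$ corresponding to the point $P$, i.e. with $[f,g]=P$. (2) If moreover $P$ does not belong to the locus $M_3^{\mathrm{Aut}}$, the converse also holds: $\mathcal{C}_P(k)\neq\emptyset$ if and only if there exists a model $(f,g)$ of $P$ defined over $k$.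
   Context: $k$ is a field of characteristic zero with algebraic closure $\bar k$. Transvectants: for binary forms $F,G$ in $X_0,X_1$ of orders $m,n$, $$(F,G)_r=\frac{(m-r)!(n-r)!}{m!\,n!}\sum_{l=0}^r(-1)^l\binom{r}{l}\frac{\partial^rF}{\partial X_0^{r-l}\partial X_1^{l}}\,\frac{\partial^rG}{\partial X_0^{l}\partial X_1^{r-l}} .$$ Cubic maps as pairs of forms: a cubic rational map $\phi=[F_0:F_1]$ ($F_0,F_1$ cubic forms without common factor over $\bar k$) is specified by the pair $(f,g)$ with $f=\partial F_0/\partial X_0+\partial F_1/\partial X_1$ (quadratic form) and $g=X_1F_0-X_0F_1$ (quartic form). The assignment $(F_0,F_1)\mapsto(f,g)$ is a linear isomorphism, so a pair $(f,g)$ determines $(F_0,F_1)$. Basic invariants of $(f,g)$: with $H=(g,g)_2$ and $T=(g,H)_1$, $$d=(f,f)_2,\quad i=(g,g)_4,\quad j=(H,g)_4,\quad a=(g,f^2)_4,\quad b=(H,f^2)_4,\quad c=(T,f^3)_6,$$ of degrees $2,2,3,3,4,6$. Moduli space: two cubic maps are conjugate under $\mathrm{PGL}_2(\bar k)$ (acting by $\phi\mapsto\gamma^{-1}\circ\phi\circ\gamma$) if and only if their invariants $(d,i,j,a,b,c)$ give the same point of the weighted projective space $\mathbb{P}(2,2,3,3,4,6)$; the coarse moduli space $M_3$ is thereby identified with the subvariety of $\mathbb{P}(2,2,3,3,4,6)$ consisting of the points $[f,g]:=[d:i:j:a:b:c](f,g)$ for pairs $(f,g)$ coming from cubic rational maps.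 Any $P\in M_3(k)$ has weighted projective coordinates with values in $k$. A model of $P$ is a pair $(f,g)$ (equivalently, a cubic rational map) with coefficients in $\bar k$ and $[f,g]=P$; it is defined over $k$ if its coefficients are in $k$. $M_3^{\mathrm{Aut}}$ is the locus of points of $M_3$ corresponding to maps $\phi$ for which $\mathrm{Aut}(\phi)=\{\gamma\in\mathrm{PGL}_2(\bar k):\gamma^{-1}\circ\phi\circ\gamma=\phi\}$ is nontrivial. Further invariants, as polynomials in the basic ones (with $C_{ij}=C_{ji}$, $B_{ij}=B_{ji}$): $C_{11}=d$, $C_{12}=a$, $C_{13}=b$, $C_{22}=b+\frac13 id$, $C_{23}=\frac16 ia+\frac13 jd$, $C_{33}=\frac13 ja-\frac16 ib+\frac1{18}i^2d$; $A_1=d$, $A_2=a$, $A_3=b$; $B_{11}=a$, $B_{12}=b+\frac13 id$, $B_{13}=\frac16 ia+\frac13 jd$, $B_{22}=\frac12 ia+\frac13 jd$, $B_{23}=\frac13 ja-\frac16 ib+\frac1{18}i^2d$, $B_{33}=\frac13 jb-\frac1{36}i^2a+\frac1{18}dij$. (They come from the quadratic covariants $u_1=f$, $u_2=(g,f)_2$, $u_3=(H,f)_2$ via $C_{ij}=(u_i,u_j)_2$, $A_i=(f,u_i)_2$, $B_{ij}=(g,u_iu_j)_4$.)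
   Formalization: The printed B_23 and B_33 have wrong signs: the terms (1/6)ib and (1/36)i²a are taken with plus instead of minus, as B_ij=(g,u_iu_j)_4 requires; with the printed signs the formula for g fails, e.g. for f=X0²+2X0X1, g=X0⁴+X1⁴. *)

theory Defs
  imports
    "HOL-Analysis.Determinants"
    "HOL-Algebra.Algebraic_Closure_Type"
begin

text \<open>
  The field \<open>k\<close> is a type \<open>'k :: field_char_0\<close>, its algebraic closure is \<open>'k alg_closure\<close> with
  embedding \<open>to_ac\<close>. Polynomials in \<open>X\<^sub>0, X\<^sub>1\<close> are elements of \<open>'a poly poly\<close>: the inner variable
  is \<open>X\<^sub>0\<close>, the outer one \<open>X\<^sub>1\<close>, so \<open>coeff (coeff F l) m\<close> is the coefficient of \<open>X\<^sub>0^m X\<^sub>1^l\<close>.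
\<close>

unbundle no fps_syntax

section \<open>Binary forms\<close>

definition cst :: "'a::comm_ring_1 \<Rightarrow> 'a poly poly"
  where "cst s = [:[:s:]:]"

definition X0 :: "'a::comm_ring_1 poly poly"
  where "X0 = [:[:0, 1:]:]"

definition X1 :: "'a::comm_ring_1 poly poly"
  where "X1 = [:0, 1:]"

text \<open>As usual, the zero polynomial is a form of every order.\<close>

definition binary_form :: "nat \<Rightarrow> 'a::comm_ring_1 poly poly \<Rightarrow> bool"
  where "binary_form n F \<longleftrightarrow> (\<forall>l m. coeff (coeff F l) m \<noteq> 0 \<longrightarrow> l + m = n)"

definition D0 :: "'a::idom poly poly \<Rightarrow> 'a poly poly"
  where "D0 F = map_poly pderiv F"

definition D1 :: "'a::idom poly poly \<Rightarrow> 'a poly poly"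
  where "D1 F = pderiv F"

definition eval_form :: "'a::comm_ring_1 poly poly \<Rightarrow> 'a ^ 2 \<Rightarrow> 'a"
  where "eval_form F z = poly (poly F [:z $ 2:]) (z $ 1)"

definition subst_form :: "'a::comm_ring_1 poly poly \<Rightarrow> 'a poly poly \<Rightarrow> 'a poly poly \<Rightarrow> 'a poly poly"
  where "subst_form F L0 L1 = poly (map_poly (\<lambda>p. poly (map_poly cst p) L0) F) L1"

text \<open>The orders of \<open>F\<close> and \<open>G\<close> are explicit arguments \<open>m\<close>, \<open>n\<close>.\<close>

definition transvectant ::
  "nat \<Rightarrow> nat \<Rightarrow> nat \<Rightarrow> 'a::field_char_0 poly poly \<Rightarrow> 'a poly poly \<Rightarrow> 'a poly poly"
  where "transvectant m n r F G =
    cst (fact (m - r) * fact (n - r) / (fact m * fact n)) *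
    (\<Sum>l\<le>r. (-1) ^ l * of_nat (r choose l)
       * (D0 ^^ (r - l)) ((D1 ^^ l) F) * (D0 ^^ l) ((D1 ^^ (r - l)) G))"

text \<open>The value of a form of order 0.\<close>

definition form_const :: "'a::comm_ring_1 poly poly \<Rightarrow> 'a"
  where "form_const F = coeff (coeff F 0) 0"

definition base_change :: "'k::field_char_0 poly poly \<Rightarrow> 'k alg_closure poly poly"
  where "base_change F = map_poly (map_poly to_ac) F"

definition defined_over_base :: "'k::field_char_0 alg_closure poly poly \<Rightarrow> bool"
  where "defined_over_base F \<longleftrightarrow> (\<forall>l m. coeff (coeff F l) m \<in> range to_ac)"

section \<open>Invariants and the weighted projective space\<close>

text \<open>Coordinates \<open>d, i, j, a, b, c\<close> of weights 2, 2, 3, 3, 4, 6.\<close>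

datatype 'a wcoords =
  WCoords (w_d: 'a) (w_i: 'a) (w_j: 'a) (w_a: 'a) (w_b: 'a) (w_c: 'a)

definition cov_H :: "'a::field_char_0 poly poly \<Rightarrow> 'a poly poly"
  where "cov_H g = transvectant 4 4 2 g g"

definition cov_T :: "'a::field_char_0 poly poly \<Rightarrow> 'a poly poly"
  where "cov_T g = transvectant 4 4 1 g (cov_H g)"

definition invariants :: "'a::field_char_0 poly poly \<Rightarrow> 'a poly poly \<Rightarrow> 'a wcoords"
  where "invariants f g = WCoords
    (form_const (transvectant 2 2 2 f f))
    (form_const (transvectant 4 4 4 g g))
    (form_const (transvectant 4 4 4 (cov_H g) g))
    (form_const (transvectant 4 4 4 g (f ^ 2)))
    (form_const (transvectant 4 4 4 (cov_H g) (f ^ 2)))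
    (form_const (transvectant 6 6 6 (cov_T g) (f ^ 3)))"

definition wscale :: "'a::field_char_0 \<Rightarrow> 'a wcoords \<Rightarrow> 'a wcoords"
  where "wscale s y = WCoords (s ^ 2 * w_d y) (s ^ 2 * w_i y) (s ^ 3 * w_j y)
                              (s ^ 3 * w_a y) (s ^ 4 * w_b y) (s ^ 6 * w_c y)"

text \<open>Points of \<open>\<P>(2,2,3,3,4,6)\<close> are the orbits of nonzero tuples under scaling.\<close>

definition wp_point :: "'a::field_char_0 wcoords \<Rightarrow> 'a wcoords set"
  where "wp_point y = {wscale s y |s. s \<noteq> 0}"

definition weighted_proj :: "'a::field_char_0 wcoords set set"
  where "weighted_proj = {wp_point y |y. y \<noteq> WCoords 0 0 0 0 0 0}"

definition c_locus :: "'a::field_char_0 wcoords set set"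
  where "c_locus = {P \<in> weighted_proj. \<exists>y \<in> P. w_c y = 0}"

section \<open>Cubic rational maps, moduli points and models\<close>

definition cubic_map :: "'a::field_char_0 poly poly \<Rightarrow> 'a poly poly \<Rightarrow> bool"
  where "cubic_map F0 F1 \<longleftrightarrow> binary_form 3 F0 \<and> binary_form 3 F1 \<and> coprime F0 F1"

definition map_f :: "'a::field_char_0 poly poly \<Rightarrow> 'a poly poly \<Rightarrow> 'a poly poly"
  where "map_f F0 F1 = D0 F0 + D1 F1"

definition map_g :: "'a::field_char_0 poly poly \<Rightarrow> 'a poly poly \<Rightarrow> 'a poly poly"
  where "map_g F0 F1 = X1 * F0 - X0 * F1"

definition moduli_point :: "'a::field_char_0 poly poly \<Rightarrow> 'a poly poly \<Rightarrow> 'a wcoords set"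
  where "moduli_point F0 F1 = wp_point (invariants (map_f F0 F1) (map_g F0 F1))"

text \<open>
  To be used with an algebraically closed field, as \<open>coprime\<close> refers to common factors over
  \<open>'a\<close> itself.
\<close>

definition M3 :: "'a::field_char_0 wcoords set set"
  where "M3 = {P \<in> weighted_proj. \<exists>F0 F1. cubic_map F0 F1 \<and> P = moduli_point F0 F1}"

definition M3_rational :: "'k::field_char_0 alg_closure wcoords set set"
  where "M3_rational = {P \<in> M3. \<exists>x :: 'k wcoords. P = wp_point (map_wcoords to_ac x)}"

definition is_model ::
  "'a::field_char_0 wcoords set \<Rightarrow> 'a poly poly \<Rightarrow> 'a poly poly \<Rightarrow> bool"
  where "is_model P f g \<longleftrightarrow>
    (\<exists>F0 F1. cubic_map F0 F1 \<and> f = map_f F0 F1 \<and> g = map_g F0 F1) \<and>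
    wp_point (invariants f g) = P"

text \<open>A matrix \<open>\<gamma>\<close> acts by \<open>[X\<^sub>0 : X\<^sub>1] \<mapsto> [\<gamma>\<^sub>1\<^sub>1 X\<^sub>0 + \<gamma>\<^sub>1\<^sub>2 X\<^sub>1 : \<gamma>\<^sub>2\<^sub>1 X\<^sub>0 + \<gamma>\<^sub>2\<^sub>2 X\<^sub>1]\<close>.\<close>

definition lin_subst :: "'a::field_char_0 ^ 2 ^ 2 \<Rightarrow> 'a poly poly \<Rightarrow> 'a poly poly"
  where "lin_subst \<gamma> F = subst_form F
    (cst (\<gamma> $ 1 $ 1) * X0 + cst (\<gamma> $ 1 $ 2) * X1)
    (cst (\<gamma> $ 2 $ 1) * X0 + cst (\<gamma> $ 2 $ 2) * X1)"

definition conj_map ::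
  "'a::field_char_0 ^ 2 ^ 2 \<Rightarrow> 'a poly poly \<times> 'a poly poly \<Rightarrow> 'a poly poly \<times> 'a poly poly"
  where "conj_map \<gamma> F = (let \<delta> = matrix_inv \<gamma>;
      G0 = lin_subst \<gamma> (fst F); G1 = lin_subst \<gamma> (snd F)
    in (cst (\<delta> $ 1 $ 1) * G0 + cst (\<delta> $ 1 $ 2) * G1,
        cst (\<delta> $ 2 $ 1) * G0 + cst (\<delta> $ 2 $ 2) * G1))"

definition same_map ::
  "'a::field_char_0 poly poly \<times> 'a poly poly \<Rightarrow> 'a poly poly \<times> 'a poly poly \<Rightarrow> bool"
  where "same_map F G \<longleftrightarrow> fst F * snd G = snd F * fst G"

definition pgl_class :: "'a::field_char_0 ^ 2 ^ 2 \<Rightarrow> ('a ^ 2 ^ 2) set"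
  where "pgl_class \<gamma> = {(\<chi> r s. t * \<gamma> $ r $ s) |t. t \<noteq> 0}"

definition Aut_map :: "'a::field_char_0 poly poly \<Rightarrow> 'a poly poly \<Rightarrow> ('a ^ 2 ^ 2) set set"
  where "Aut_map F0 F1 =
    {pgl_class \<gamma> |\<gamma>. invertible \<gamma> \<and> same_map (conj_map \<gamma> (F0, F1)) (F0, F1)}"

definition M3_Aut :: "'a::field_char_0 wcoords set set"
  where "M3_Aut = {P \<in> M3. \<exists>F0 F1. cubic_map F0 F1 \<and> P = moduli_point F0 F1 \<and>
                              Aut_map F0 F1 \<noteq> {pgl_class (mat 1)}}"

section \<open>The conic and its parametrizations\<close>

definition C_mat :: "'a::field_char_0 wcoords \<Rightarrow> 'a ^ 3 ^ 3"
  where "C_mat x = (case x of WCoords d i j a b c \<Rightarrow> vector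
    [vector [d, a, b],
     vector [a, b + 1/3 * i * d, 1/6 * i * a + 1/3 * j * d],
     vector [b, 1/6 * i * a + 1/3 * j * d,
             1/3 * j * a - 1/6 * i * b + 1/18 * i ^ 2 * d]])"

definition A_vec :: "'a::field_char_0 wcoords \<Rightarrow> 'a ^ 3"
  where "A_vec x = vector [w_d x, w_a x, w_b x]"

text \<open>
  These are the values \<open>B\<^sub>i\<^sub>j = (g, u\<^sub>i u\<^sub>j)\<^sub>4\<close> for \<open>u\<^sub>1 = f\<close>, \<open>u\<^sub>2 = (g, f)\<^sub>2\<close>, \<open>u\<^sub>3 = (H, f)\<^sub>2\<close>; see
  \<open>B_mat_covariants\<close> below. The source prints \<open>B\<^sub>2\<^sub>3\<close> and \<open>B\<^sub>3\<^sub>3\<close> with the opposite sign in the terms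
  \<open>1/6 i b\<close> and \<open>1/36 i\<^sup>2 a\<close>, which contradicts that origin: since \<open>(g, u\<^sub>2)\<^sub>2 = u\<^sub>3 + i/3 u\<^sub>1\<close> and
  \<open>(g, u\<^sub>3)\<^sub>2 = i/6 u\<^sub>2 + j/3 u\<^sub>1\<close>, one has \<open>B\<^sub>2\<^sub>3 = C\<^sub>3\<^sub>3 + i/3 C\<^sub>1\<^sub>3\<close> and
  \<open>B\<^sub>3\<^sub>3 = i/6 C\<^sub>2\<^sub>3 + j/3 C\<^sub>1\<^sub>3\<close>.
\<close>

definition B_mat :: "'a::field_char_0 wcoords \<Rightarrow> 'a ^ 3 ^ 3"
  where "B_mat x = (case x of WCoords d i j a b c \<Rightarrow> vector
    [vector [a, b + 1/3 * i * d, 1/6 * i * a + 1/3 * j * d],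
     vector [b + 1/3 * i * d, 1/2 * i * a + 1/3 * j * d,
             1/3 * j * a + 1/6 * i * b + 1/18 * i ^ 2 * d],
     vector [1/6 * i * a + 1/3 * j * d, 1/3 * j * a + 1/6 * i * b + 1/18 * i ^ 2 * d,
             1/3 * j * b + 1/36 * i ^ 2 * a + 1/18 * d * i * j]])"

text \<open>
  Consistency of \<open>C_mat\<close> and \<open>B_mat\<close> with the transvectants they come from, via the values of the
  transvectants on generic quadratic and quartic forms.
\<close>

definition covs :: "'a::field_char_0 poly poly \<Rightarrow> 'a poly poly \<Rightarrow> 'a poly poly ^ 3"
  where "covs f g = vector [f, transvectant 4 2 2 g f, transvectant 4 2 2 (cov_H g) f]"

definition quad :: "'a::field_char_0 \<Rightarrow> 'a \<Rightarrow> 'a \<Rightarrow> 'a poly poly"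
  where "quad a b c = [:[:0, 0, a:], [:0, 2 * b:], [:c:]:]"

definition quart :: "'a::field_char_0 \<Rightarrow> 'a \<Rightarrow> 'a \<Rightarrow> 'a \<Rightarrow> 'a \<Rightarrow> 'a poly poly"
  where "quart a b c d e =
    [:[:0, 0, 0, 0, a:], [:0, 0, 0, 4 * b:], [:0, 0, 6 * c:], [:0, 4 * d:], [:e:]:]"

lemma binary_form_2_quad:
  assumes "binary_form 2 (f :: 'a::field_char_0 poly poly)"
  shows "\<exists>a b c. f = quad a b c"
proof -
  have z: "coeff (coeff f l) m = 0" if "l + m \<noteq> 2" for l m
    using assms that unfolding binary_form_def by blast
  have "coeff (coeff f l) m =
    coeff (coeff (quad (coeff (coeff f 0) 2) (coeff (coeff f 1) 1 / 2) (coeff (coeff f 2) 0)) l) m"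
    for l m
    unfolding quad_def using z by (auto simp: coeff_pCons numeral_eq_Suc split: nat.splits)
  then show ?thesis by (metis poly_eqI)
qed

lemma binary_form_4_quart:
  assumes "binary_form 4 (f :: 'a::field_char_0 poly poly)"
  shows "\<exists>a b c d e. f = quart a b c d e"
proof -
  have z: "coeff (coeff f l) m = 0" if "l + m \<noteq> 4" for l m
    using assms that unfolding binary_form_def by blast
  have "coeff (coeff f l) m =
    coeff (coeff (quart (coeff (coeff f 0) 4) (coeff (coeff f 1) 3 / 4) (coeff (coeff f 2) 2 / 6)
                        (coeff (coeff f 3) 1 / 4) (coeff (coeff f 4) 0)) l) m"
    for l m
    unfolding quart_def using z by (auto simp: coeff_pCons numeral_eq_Suc split: nat.splits)
  then show ?thesis by (metis poly_eqI)
qed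

lemma D_pCons:
  "D0 0 = 0" "D0 (pCons (p :: 'a::field_char_0 poly) F) = pCons (pderiv p) (D0 F)"
  "D1 0 = 0" "D1 (pCons (p :: 'a::field_char_0 poly) F) = F + pCons 0 (D1 F)"
  by (simp_all add: D0_def D1_def map_poly_pCons pderiv_pCons)

lemma transvectant_quad_quad:
  "transvectant 2 2 2 (quad a b c) (quad a' b' c') = cst (a * c' - 2 * b * b' + c * a')"
  unfolding transvectant_def quad_def
  by (simp add: numeral_2_eq_2 D_pCons pderiv_pCons of_nat_poly cst_def)

lemma transvectant_quart_quad:
  "transvectant 4 2 2 (quart p q r s t) (quad a b c) =
   quad (p * c - 2 * q * b + r * a) (q * c - 2 * r * b + s * a) (r * c - 2 * s * b + t * a)"
  unfolding transvectant_def quad_def quart_def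
  by (simp add: eval_nat_numeral fact_numeral D_pCons pderiv_pCons of_nat_poly cst_def)
     (simp add: field_simps)?

lemma transvectant_quart_quart_2:
  "transvectant 4 4 2 (quart p q r s t) (quart p q r s t) =
   quart (2 * (p * r - q * q)) (p * s - q * r) ((p * t + 2 * q * s - 3 * r * r) / 3)
         (q * t - r * s) (2 * (r * t - s * s))"
  unfolding transvectant_def quart_def
  by (simp add: eval_nat_numeral fact_numeral D_pCons pderiv_pCons of_nat_poly cst_def)
     (simp add: field_simps)?

lemma transvectant_quart_quart_4:
  "transvectant 4 4 4 (quart p q r s t) (quart p' q' r' s' t') =
   cst (p * t' - 4 * q * s' + 6 * r * r' - 4 * s * q' + t * p')"
  unfolding transvectant_def quart_def
  by (simp add: eval_nat_numeral fact_numeral D_pCons pderiv_pCons of_nat_poly cst_def)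
     (simp add: field_simps)?

lemma quad_mult_quad:
  "quad a b c * quad a' b' c' =
   quart (a * a') ((a * b' + b * a') / 2) ((a * c' + 4 * b * b' + c * a') / 6)
         ((b * c' + c * b') / 2) (c * c')"
  by (simp add: quad_def quart_def algebra_simps)

lemma form_const_cst: "form_const (cst s) = s"
  by (simp add: form_const_def cst_def)

lemmas quad_quart_simps =
  transvectant_quad_quad transvectant_quart_quad transvectant_quart_quart_2
  transvectant_quart_quart_4 quad_mult_quad form_const_cst

text \<open>
  \<open>F \<mapsto> (g, F)\<^sub>2\<close> is self-adjoint for the pairing \<open>(F, G) \<mapsto> (F, G)\<^sub>2\<close> on quadratic forms, and the
  forms \<open>(g, u\<^sub>2)\<^sub>2\<close>, \<open>(g, u\<^sub>3)\<^sub>2\<close>, \<open>(H, u\<^sub>3)\<^sub>2\<close> are linear combinations of \<open>u\<^sub>1, u\<^sub>2, u\<^sub>3\<close>.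
\<close>

lemma quart_quad_adjoint:
  fixes F G :: "'a::field_char_0 poly poly"
  assumes "g = quart p0 p1 p2 p3 p4" "F = quad a b c" "G = quad a' b' c'"
  shows "form_const (transvectant 4 4 4 g (F * G)) =
         form_const (transvectant 2 2 2 (transvectant 4 2 2 g F) G)"
    and "form_const (transvectant 2 2 2 (transvectant 4 2 2 g F) G) =
         form_const (transvectant 2 2 2 F (transvectant 4 2 2 g G))"
  unfolding assms quad_quart_simps by (simp_all add: field_simps)

lemma quad_pairing_commute:
  fixes F G :: "'a::field_char_0 poly poly"
  assumes "F = quad a b c" "G = quad a' b' c'"
  shows "form_const (transvectant 2 2 2 F G) = form_const (transvectant 2 2 2 G F)"
  unfolding assms quad_quart_simps by (simp add: field_simps)

lemma quad_pairing_linear: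
  fixes F1 F2 F3 G :: "'a::field_char_0 poly poly"
  assumes "F1 = quad a1 b1 c1" "F2 = quad a2 b2 c2" "F3 = quad a3 b3 c3" "G = quad a b c"
  shows "form_const (transvectant 2 2 2 (cst x * F1 + cst y * F2 + cst z * F3) G) =
    x * form_const (transvectant 2 2 2 F1 G) + y * form_const (transvectant 2 2 2 F2 G)
    + z * form_const (transvectant 2 2 2 F3 G)"
proof -
  have "cst x * F1 + cst y * F2 + cst z * F3 =
    quad (x * a1 + y * a2 + z * a3) (x * b1 + y * b2 + z * b3) (x * c1 + y * c2 + z * c3)"
    unfolding assms by (simp add: quad_def cst_def algebra_simps)
  then show ?thesis
    unfolding assms by (simp add: quad_quart_simps algebra_simps)
qed

lemma quad_lin_comb_eqI:
  fixes x y z :: "'a::field_char_0"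
  assumes "a = x * a1 + y * a2 + z * a3" "b = x * b1 + y * b2 + z * b3"
    "c = x * c1 + y * c2 + z * c3"
  shows "quad a b c = cst x * quad a1 b1 c1 + cst y * quad a2 b2 c2 + cst z * quad a3 b3 c3"
  unfolding assms by (simp add: quad_def cst_def algebra_simps)

lemma mat_covariants:
  fixes f g :: "'a::field_char_0 poly poly"
  assumes "binary_form 2 f" "binary_form 4 g"
  shows C_mat_covariants: "C_mat (invariants f g) $ r $ s =
               form_const (transvectant 2 2 2 (covs f g $ r) (covs f g $ s))"
    and B_mat_covariants: "B_mat (invariants f g) $ r $ s =
               form_const (transvectant 4 4 4 g (covs f g $ r * covs f g $ s))"
proof -
  obtain a1 b1 c1 where f: "f = quad a1 b1 c1" using binary_form_2_quad assms by blast
  obtain p0 p1 p2 p3 p4 where g: "g = quart p0 p1 p2 p3 p4"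
    using binary_form_4_quart assms by blast
  define u2 where "u2 = transvectant 4 2 2 g f"
  define u3 where "u3 = transvectant 4 2 2 (cov_H g) f"
  define i where "i = form_const (transvectant 4 4 4 g g)"
  define j where "j = form_const (transvectant 4 4 4 (cov_H g) g)"
  define ip where "ip F G = form_const (transvectant 2 2 2 F G)" for F G :: "'a poly poly"
  obtain h0 h1 h2 h3 h4 where H: "cov_H g = quart h0 h1 h2 h3 h4"
    unfolding cov_H_def g transvectant_quart_quart_2 by blast
  obtain a2 b2 c2 where u2: "u2 = quad a2 b2 c2"
    unfolding u2_def f g transvectant_quart_quad by blast
  obtain a3 b3 c3 where u3: "u3 = quad a3 b3 c3"
    unfolding u3_def f H transvectant_quart_quad by blast
  note defs = u2_def u3_def i_def j_def f g cov_H_def quad_quart_simps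
  have gu2: "transvectant 4 2 2 g u2 = cst (i / 3) * f + cst 0 * u2 + cst 1 * u3"
    unfolding defs by (rule quad_lin_comb_eqI) (simp_all add: field_simps)
  have gu3: "transvectant 4 2 2 g u3 = cst (j / 3) * f + cst (i / 6) * u2 + cst 0 * u3"
    unfolding defs by (rule quad_lin_comb_eqI) (simp_all add: field_simps)
  have Hu3: "transvectant 4 2 2 (cov_H g) u3 =
      cst (i ^ 2 / 18) * f + cst (j / 3) * u2 + cst (- i / 6) * u3"
    unfolding defs by (rule quad_lin_comb_eqI) (simp_all add: field_simps power2_eq_square)
  note lin = quad_pairing_linear[OF f u2 u3, folded ip_def]
  note sym = quad_pairing_commute[where 'a = 'a, folded ip_def]
  note mult = quart_quad_adjoint(1)[where 'a = 'a, folded ip_def]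
  note adj = quart_quad_adjoint(2)[where 'a = 'a, folded ip_def]
  define d where "d = ip f f"
  define a where "a = ip u2 f"
  define b where "b = ip u3 f"
  have inv: "w_d (invariants f g) = d" "w_i (invariants f g) = i" "w_j (invariants f g) = j"
    "w_a (invariants f g) = a" "w_b (invariants f g) = b"
    using mult[OF g f f] mult[OF H f f]
    by (simp_all add: invariants_def i_def j_def d_def a_def b_def u2_def u3_def ip_def
        power2_eq_square)
  note G = lin[OF f] lin[OF u2] lin[OF u3]
  have 1: "ip f f = d" "ip u2 f = a" "ip f u2 = a" "ip u3 f = b" "ip f u3 = b"
    using sym[OF f u2] sym[OF f u3] by (simp_all add: d_def a_def b_def)
  have 2: "ip u2 u2 = b + i * d / 3"
    using adj[OF g u2 f] unfolding gu2 u2_def[symmetric] G 1 by (simp add: algebra_simps)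
  have 3: "ip u3 u2 = i * a / 6 + j * d / 3"
    using adj[OF g u3 f] unfolding gu3 u2_def[symmetric] G 1 by (simp add: algebra_simps)
  have 4: "ip u2 u3 = i * a / 6 + j * d / 3"
    using 3 sym[OF u2 u3] by simp
  have 5: "ip u3 u3 = j * a / 3 - i * b / 6 + i ^ 2 * d / 18"
    using adj[OF H u3 f] unfolding Hu3 u3_def[symmetric] G 1 by (simp add: algebra_simps)
  note ips = 1 2 3 4 5
  note mults = mult[OF g f f] mult[OF g f u2] mult[OF g f u3]
    mult[OF g u2 f] mult[OF g u2 u2] mult[OF g u2 u3]
    mult[OF g u3 f] mult[OF g u3 u2] mult[OF g u3 u3]
  obtain c where w: "invariants f g = WCoords d i j a b c"
    using inv by (metis wcoords.collapse)
  have covs: "covs f g = vector [f, u2, u3]"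
    by (simp add: covs_def u2_def u3_def)
  have "\<forall>r s. C_mat (invariants f g) $ r $ s = ip (covs f g $ r) (covs f g $ s)"
    by (simp add: forall_3 C_mat_def w covs ips field_simps)
  then show "C_mat (invariants f g) $ r $ s =
      form_const (transvectant 2 2 2 (covs f g $ r) (covs f g $ s))"
    by (simp add: ip_def)
  have "\<forall>r s. B_mat (invariants f g) $ r $ s =
      form_const (transvectant 4 4 4 g (covs f g $ r * covs f g $ s))"
    unfolding forall_3 covs vector_3 mults gu2 gu3 u2_def[symmetric] G
    by (simp add: B_mat_def w ips field_simps power2_eq_square)
  then show "B_mat (invariants f g) $ r $ s =
      form_const (transvectant 4 4 4 g (covs f g $ r * covs f g $ s))"
    by blast
qed

definition proj_eq :: "'a::field_char_0 ^ 'n \<Rightarrow> 'a ^ 'n \<Rightarrow> bool"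
  where "proj_eq p q \<longleftrightarrow> (\<exists>s. s \<noteq> 0 \<and> q = s *s p)"

text \<open>The points of the conic with symmetric matrix \<open>M\<close>, given by homogeneous coordinates.\<close>

definition conic_points :: "'a::field_char_0 ^ 3 ^ 3 \<Rightarrow> ('a ^ 3) set"
  where "conic_points M =
    {p. p \<noteq> 0 \<and> (\<Sum>r\<in>UNIV. \<Sum>s\<in>UNIV. M $ r $ s * p $ r * p $ s) = 0}"

definition vec_ac :: "'k::field_char_0 ^ 'n \<Rightarrow> 'k alg_closure ^ 'n"
  where "vec_ac p = (\<chi> r. to_ac (p $ r))"

definition theta_ac :: "'k::field_char_0 poly poly ^ 3 \<Rightarrow> 'k alg_closure ^ 2 \<Rightarrow> 'k alg_closure ^ 3"
  where "theta_ac \<theta> z = (\<chi> r. eval_form (base_change (\<theta> $ r)) z)"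

text \<open>
  \<open>\<theta>\<close> is a triple of quadratic forms over \<open>k\<close> that induces a bijective morphism from \<open>\<P>\<^sup>1\<close> to the
  conic over the algebraic closure. For a smooth conic in characteristic zero this means that it
  is an isomorphism.
\<close>

definition conic_parametrization :: "'k::field_char_0 wcoords \<Rightarrow> 'k poly poly ^ 3 \<Rightarrow> bool"
  where "conic_parametrization x \<theta> \<longleftrightarrow>
    (\<forall>r. binary_form 2 (\<theta> $ r)) \<and>
    (\<Sum>r\<in>UNIV. \<Sum>s\<in>UNIV. cst (C_mat x $ r $ s) * \<theta> $ r * \<theta> $ s) = 0 \<and>
    (\<forall>z. z \<noteq> 0 \<longrightarrow> theta_ac \<theta> z \<noteq> 0) \<and>
    (\<forall>z w. z \<noteq> 0 \<and> w \<noteq> 0 \<and> proj_eq (theta_ac \<theta> z) (theta_ac \<theta> w) \<longrightarrow> proj_eq z w) \<and>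
    (\<forall>p \<in> conic_points (C_mat (map_wcoords to_ac x)). \<exists>z. z \<noteq> 0 \<and> proj_eq (theta_ac \<theta> z) p)"

text \<open>
  \<open>\<theta>\<close> is inverse to the projection from \<open>q\<close>: after some \<open>k\<close>-linear identification
  \<open>z \<mapsto> z\<^sub>1 v\<^sub>0 + z\<^sub>2 v\<^sub>1\<close> of \<open>\<P>\<^sup>1\<close> with the pencil of lines through \<open>q\<close>, the point \<open>\<theta>(z)\<close> lies on
  the line joining \<open>q\<close> and \<open>z\<^sub>1 v\<^sub>0 + z\<^sub>2 v\<^sub>1\<close>.
\<close>

definition projects_from :: "'k::field_char_0 ^ 3 \<Rightarrow> 'k poly poly ^ 3 \<Rightarrow> bool"
  where "projects_from q \<theta> \<longleftrightarrow>
    (\<exists>v0 v1 :: 'k ^ 3. det (vector [q, v0, v1] :: 'k ^ 3 ^ 3) \<noteq> 0 \<and>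
      (\<forall>z. det (vector [theta_ac \<theta> z, vec_ac q, z $ 1 *s vec_ac v0 + z $ 2 *s vec_ac v1]
                  :: 'k alg_closure ^ 3 ^ 3) = 0))"

end

theory Submission
  imports Defs
begin

text \<open>
  Let \<open>K\<close> be the algebraic closure of \<open>k\<close> and let \<open>(f, g)\<close> be a pair over \<open>K\<close> whose invariants are
  the given coordinates \<open>x\<close> of \<open>P\<close>. Write \<open>u\<^sub>1, u\<^sub>2, u\<^sub>3\<close> for its quadratic covariants. The invariant
  \<open>c\<close> is the determinant of the coefficients of the \<open>u\<^sub>r\<close> (\<open>w_c_cov_mat\<close>), so for \<open>c \<noteq> 0\<close> they are a
  basis of the quadratic forms, and \<open>C\<^sub>r\<^sub>s\<close> is the Gram matrix of the nondegenerate pairing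
  \<open>(_, _)\<^sub>2\<close> in that basis. A quadratic form is isotropic for this pairing iff it is a square of a
  linear form. Hence the points of the conic are the coordinate vectors of such squares: if
  \<open>l\<^sub>z = z\<^sub>1 X\<^sub>1 - z\<^sub>2 X\<^sub>0\<close> and \<open>\<Sum> \<theta>\<^sub>r(z) u\<^sub>r = l\<^sub>z\<^sup>2\<close>, then \<open>\<theta>\<close> parametrizes the conic, and
  \<open>\<Sum> A\<^sub>r \<theta>\<^sub>r(z) = (f, l\<^sub>z\<^sup>2)\<^sub>2 = f(z)\<close> and \<open>\<Sum> B\<^sub>r\<^sub>s \<theta>\<^sub>r(z) \<theta>\<^sub>s(z) = (g, l\<^sub>z\<^sup>4)\<^sub>4 = g(z)\<close>.

  For any other parametrization \<open>\<theta>\<close>, the form \<open>\<Sum> \<theta>\<^sub>r u\<^sub>r = P X\<^sub>0\<^sup>2 + 2 Q X\<^sub>0 X\<^sub>1 + R X\<^sub>1\<^sup>2\<close> has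
  linearly independent coefficients \<open>P, Q, R\<close> with \<open>P R = Q\<^sup>2\<close>. This forces \<open>P\<close> and \<open>R\<close> to be squares
  of linear forms (\<open>independent_quads_square\<close>), so \<open>\<theta>\<close> arises from the one above by a linear
  substitution \<open>M\<close>, and the two sums become \<open>f \<circ> M\<close> and \<open>g \<circ> M\<close> (\<open>reparametrize\<close>). The invariants
  of \<open>(f \<circ> M, g \<circ> M)\<close> differ from those of \<open>(f, g)\<close> by powers of \<open>det M\<close>, and dividing the two forms
  by \<open>det M\<close> and \<open>(det M)\<^sup>2\<close> restores \<open>x\<close>. If \<open>\<theta>\<close> is defined over \<open>k\<close>, then so is \<open>det M\<close>: its
  square is a value of the polarized equation of the conic and its cube is \<open>2 c\<close> times the
  determinant of the coefficients of \<open>\<theta>\<close>. Thus \<open>\<beta> = det M / c\<close> works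
  (\<open>model_from_parametrization\<close>). A point \<open>q\<close> of the conic over \<open>k\<close> yields a parametrization over \<open>k\<close>
  by the inverse of the projection from \<open>q\<close> (\<open>second_point_parametrizes\<close>).

  Conversely, for a model over \<open>k\<close> the coordinates of the square \<open>X\<^sub>0\<^sup>2\<close> in the basis \<open>u\<^sub>r\<close> are a point
  over \<open>k\<close> on the conic of its invariants \<open>y\<close>. Here \<open>y\<close> is obtained from \<open>x\<close> by the weighted action
  of some \<open>s \<in> K\<close>, and the two conics are isomorphic over \<open>k\<close> as soon as \<open>s \<in> k\<close>. The powers \<open>s\<^sup>w\<close> for
  the weights \<open>w\<close> of the nonzero coordinates are in \<open>k\<close>, so \<open>s \<in> k\<close> unless \<open>x\<close> is fixed by \<open>\<zeta> = -1\<close> or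
  by a primitive cube root of unity \<open>\<zeta>\<close>. In that case \<open>(f, g)\<close> and \<open>(\<zeta> f, \<zeta> g)\<close> have the same
  invariants. By the reconstruction they are equivalent under \<open>SL\<^sub>2\<close>
  (\<open>same_invariants_equivalent\<close>), and the substitution relating them is a nontrivial automorphism of
  the cubic map.
\<close>

(* Otherwise the index notation of vectors competes with that of power series. *)
no_notation fps_nth (infixl \<open>$\<close> 75)

section \<open>Linear substitutions\<close>

lemma cst_hom:
  fixes s t :: "'a::comm_ring_1"
  shows "cst (0 :: 'a) = 0" "cst (1 :: 'a) = 1" "cst (s + t) = cst s + cst t"
  "cst (s * t) = cst s * cst t"
  "cst (- s) = - cst s" "cst (s - t) = cst s - cst t" "cst (s ^ n) = cst s ^ n"
  "cst (numeral k :: 'a) = numeral k"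
proof -
  show m: "cst (s * t) = cst s * cst t" for s t :: 'a by (simp add: cst_def)
  show "cst 1 = (1 :: 'a poly poly)" by (simp add: cst_def one_pCons)
  then show "cst (s ^ n) = cst s ^ n" by (induction n) (simp_all add: m)
  show "cst (numeral k) = (numeral k :: 'a poly poly)" by (simp add: cst_def numeral_poly)
qed (simp_all add: cst_def)

lemma cst_eq_iff [simp]: "cst s = cst t \<longleftrightarrow> s = t"
  by (simp add: cst_def)

lemma inner_subst_hom:
  fixes L :: "'a::comm_ring_1 poly poly"
  defines "h \<equiv> \<lambda>p. poly (map_poly cst p) L"
  shows "h 0 = 0" "h (pCons a p) = cst a + L * h p" "h (p + q) = h p + h q" "h (p * q) = h p * h q"
proof -
  show 0: "h 0 = 0" by (simp add: h_def)
  show C: "h (pCons a p) = cst a + L * h p" for a p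
    by (simp add: h_def map_poly_pCons cst_hom)
  show A: "h (p + q) = h p + h q" for p q
    by (induction p q rule: poly_induct2) (simp_all add: C 0 cst_hom algebra_simps)
  have S: "h (smult a q) = cst a * h q" for a q
    by (induction q) (simp_all add: C 0 cst_hom algebra_simps)
  show "h (p * q) = h p * h q"
    by (induction p) (simp_all add: C 0 A S cst_hom algebra_simps)
qed

lemma subst_form_hom:
  fixes L0 L1 :: "'a::comm_ring_1 poly poly"
  defines "h \<equiv> \<lambda>F. subst_form F L0 L1"
  shows "h 0 = 0" "h (pCons p F) = poly (map_poly cst p) L0 + L1 * h F"
    "h (F + G) = h F + h G" "h (F * G) = h F * h G"
    "h (cst s) = cst s" "h X0 = L0" "h X1 = L1"
proof -
  show 0: "h 0 = 0" by (simp add: h_def subst_form_def)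
  show C: "h (pCons p F) = poly (map_poly cst p) L0 + L1 * h F" for p F
    by (simp add: h_def subst_form_def map_poly_pCons)
  show A: "h (F + G) = h F + h G" for F G
    by (induction F G rule: poly_induct2) (simp_all add: C 0 inner_subst_hom algebra_simps)
  have S: "h (smult p G) = poly (map_poly cst p) L0 * h G" for p G
    by (induction G) (simp_all add: C 0 inner_subst_hom algebra_simps)
  show "h (F * G) = h F * h G"
    by (induction F) (simp_all add: C 0 A S inner_subst_hom algebra_simps)
  show "h (cst s) = cst s" "h X0 = L0" "h X1 = L1"
    by (simp_all add: cst_def[of s] X0_def X1_def C 0 inner_subst_hom cst_hom)
qed

text \<open>
  The constants together with \<open>X\<^sub>0\<close> and \<open>X\<^sub>1\<close> generate the polynomial ring.
\<close>

lemma poly_poly_hom_ext: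
  fixes h h' :: "'a::comm_ring_1 poly poly \<Rightarrow> 'a poly poly"
  assumes add: "\<And>F G. h (F + G) = h F + h G" "\<And>F G. h' (F + G) = h' F + h' G"
    and mult: "\<And>F G. h (F * G) = h F * h G" "\<And>F G. h' (F * G) = h' F * h' G"
    and gen: "\<And>s. h (cst s) = h' (cst s)" "h X0 = h' X0" "h X1 = h' X1"
  shows "h F = h' F"
proof -
  have 0: "h 0 = h' 0" using gen(1)[of 0] by (simp add: cst_hom)
  have inner: "h [:p:] = h' [:p:]" for p
  proof (induction p)
    case (pCons a p)
    have "[:pCons a p:] = cst a + X0 * [:p:]" by (simp add: cst_def X0_def)
    then show ?case using pCons by (simp only: add mult gen)
  qed (simp add: 0)
  show ?thesis
  proof (induction F)
    case (pCons p F)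
    have "pCons p F = [:p:] + X1 * F" by (simp add: X1_def)
    then show ?case using pCons by (simp only: add mult inner gen)
  qed (simp add: 0)
qed

text \<open>
  The images of \<open>X\<^sub>0\<close> and \<open>X\<^sub>1\<close> under the substitution by \<open>M\<close>.
\<close>

definition lin_form :: "'a::field_char_0 ^ 2 ^ 2 \<Rightarrow> 2 \<Rightarrow> 'a poly poly"
  where "lin_form M r = cst (M $ r $ 1) * X0 + cst (M $ r $ 2) * X1"

lemma lin_subst_hom:
  fixes M :: "'a::field_char_0 ^ 2 ^ 2"
  shows "lin_subst M 0 = 0" "lin_subst M (F + G) = lin_subst M F + lin_subst M G"
    "lin_subst M (F * G) = lin_subst M F * lin_subst M G"
    "lin_subst M (cst s) = cst s" "lin_subst M X0 = lin_form M 1" "lin_subst M X1 = lin_form M 2"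
    "lin_subst M 1 = 1" "lin_subst M (- F) = - lin_subst M F"
    "lin_subst M (F - G) = lin_subst M F - lin_subst M G"
    "lin_subst M (F ^ n) = lin_subst M F ^ n" "lin_subst M (numeral k) = numeral k"
proof -
  note h = subst_form_hom
  show 0: "lin_subst M 0 = 0" and A: "lin_subst M (F + G) = lin_subst M F + lin_subst M G"
    and T: "lin_subst M (F * G) = lin_subst M F * lin_subst M G"
    and C: "lin_subst M (cst s) = cst s"
      "lin_subst M X0 = lin_form M 1" "lin_subst M X1 = lin_form M 2"
    for F G s by (simp_all add: lin_subst_def h lin_form_def)
  show 1: "lin_subst M 1 = 1" using C(1)[of 1] by (simp add: cst_hom)
  show N: "lin_subst M (- F) = - lin_subst M F" for F
    using A[of F "- F"] 0 by (simp add: eq_neg_iff_add_eq_0 add.commute)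
  show "lin_subst M (F - G) = lin_subst M F - lin_subst M G"
    using A[of F "- G"] N by simp
  show "lin_subst M (F ^ n) = lin_subst M F ^ n" by (induction n) (simp_all add: 1 T)
  show "lin_subst M (numeral k) = numeral k" using C(1)[of "numeral k"] by (simp add: cst_hom)
qed

lemma lin_subst_compose: "lin_subst M (lin_subst N F) = lin_subst (N ** M) F"
proof (rule poly_poly_hom_ext[where h = "\<lambda>F. lin_subst M (lin_subst N F)"])
  have "lin_subst M (lin_form N r) = lin_form (N ** M) r" for r
    by (simp add: lin_form_def lin_subst_hom matrix_matrix_mult_def sum_2 cst_hom algebra_simps)
  then show "lin_subst M (lin_subst N X0) = lin_subst (N ** M) X0"
    "lin_subst M (lin_subst N X1) = lin_subst (N ** M) X1"
    by (simp_all add: lin_subst_hom)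
qed (simp_all add: lin_subst_hom)

lemma lin_subst_id: "lin_subst (mat 1) F = F"
  by (rule poly_poly_hom_ext[where h' = "\<lambda>F. F"])
    (simp_all add: lin_subst_hom lin_form_def mat_def cst_hom)

lemma quad_eq: "quad a b c = cst a * X0 ^ 2 + 2 * cst b * (X0 * X1) + cst c * X1 ^ 2"
  by (simp add: quad_def cst_def X0_def X1_def power2_eq_square numeral_poly algebra_simps)

lemma quart_eq:
  "quart a b c d e = cst a * X0 ^ 4 + 4 * cst b * (X0 ^ 3 * X1) + 6 * cst c * (X0 ^ 2 * X1 ^ 2)
     + 4 * cst d * (X0 * X1 ^ 3) + cst e * X1 ^ 4"
  by (simp add: quart_def cst_def X0_def X1_def eval_nat_numeral numeral_poly algebra_simps)

text \<open>
  In contrast to \<open>quad\<close> and \<open>quart\<close>, the coefficients carry no binomial factors.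
\<close>

definition cub :: "'a::field_char_0 \<Rightarrow> 'a \<Rightarrow> 'a \<Rightarrow> 'a \<Rightarrow> 'a poly poly"
  where "cub a b c d = [:[:0, 0, 0, a:], [:0, 0, b:], [:0, c:], [:d:]:]"

lemma cub_eq:
  "cub a b c d = cst a * X0 ^ 3 + cst b * (X0 ^ 2 * X1) + cst c * (X0 * X1 ^ 2) + cst d * X1 ^ 3"
  by (simp add: cub_def cst_def X0_def X1_def eval_nat_numeral algebra_simps)

lemma lin_subst_quad:
  "lin_subst M (quad a b c) = cst a * lin_form M 1 ^ 2
     + 2 * cst b * (lin_form M 1 * lin_form M 2) + cst c * lin_form M 2 ^ 2"
  by (simp add: quad_eq lin_subst_hom)

lemma lin_subst_quart:
  "lin_subst M (quart a b c d e) = cst a * lin_form M 1 ^ 4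
     + 4 * cst b * (lin_form M 1 ^ 3 * lin_form M 2)
     + 6 * cst c * (lin_form M 1 ^ 2 * lin_form M 2 ^ 2)
     + 4 * cst d * (lin_form M 1 * lin_form M 2 ^ 3) + cst e * lin_form M 2 ^ 4"
  by (simp add: quart_eq lin_subst_hom)

lemma lin_subst_cub:
  "lin_subst M (cub a b c d) = cst a * lin_form M 1 ^ 3 + cst b * (lin_form M 1 ^ 2 * lin_form M 2)
     + cst c * (lin_form M 1 * lin_form M 2 ^ 2) + cst d * lin_form M 2 ^ 3"
  by (simp add: cub_eq lin_subst_hom)

lemma lin_subst_quad_coords:
  fixes M :: "'a::field_char_0 ^ 2 ^ 2"
  assumes "M $ 1 $ 1 = k" "M $ 1 $ 2 = l" "M $ 2 $ 1 = m" "M $ 2 $ 2 = n"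
  shows "lin_subst M (quad a b c) = quad (a*k^2 + 2*b*k*m + c*m^2)
    (a*k*l + b*(k*n + l*m) + c*m*n) (a*l^2 + 2*b*l*n + c*n^2)"
  unfolding lin_subst_quad lin_form_def assms unfolding quad_eq cst_hom by Groebner_Basis.algebra

lemma lin_subst_quart_coords:
  fixes M :: "'a::field_char_0 ^ 2 ^ 2"
  assumes "M $ 1 $ 1 = k" "M $ 1 $ 2 = l" "M $ 2 $ 1 = m" "M $ 2 $ 2 = n"
  shows "lin_subst M (quart p q r s t) = quart
    (p*k^4 + 4*q*k^3*m + 6*r*k^2*m^2 + 4 * s * k*m^3 + t*m^4)
    (p*k^3*l + q*(k^3*n + 3*k^2*l*m) + 3*r*(k^2*m*n + k*l*m^2) + s * (l*m^3 + 3*k*m^2*n) + t*m^3*n)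
    (p*k^2*l^2 + 2*q*(k^2*l*n + k*l^2*m) + r*(k^2*n^2 + 4*k*l*m*n + l^2*m^2)
        + 2 * s * (k*m*n^2 + l*m^2*n) + t*m^2*n^2)
    (p*k*l^3 + q*(l^3*m + 3*k*l^2*n) + 3*r*(l^2*m*n + k*l*n^2) + s * (k*n^3 + 3*l*m*n^2) + t*m*n^3)
    (p*l^4 + 4*q*l^3*n + 6*r*l^2*n^2 + 4 * s * l*n^3 + t*n^4)"
  unfolding lin_subst_quart lin_form_def assms unfolding quart_eq cst_hom by Groebner_Basis.algebra

section \<open>Invariants in coordinates\<close>

text \<open>
  The middle coefficient is halved, so that these are the coordinates used by \<open>quad\<close> and the
  squares of linear forms satisfy \<open>v\<^sub>2\<^sup>2 = v\<^sub>1 v\<^sub>3\<close>.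
\<close>

definition qvec :: "'a::field_char_0 poly poly \<Rightarrow> 'a ^ 3"
  where "qvec F = vector [coeff (coeff F 0) 2, coeff (coeff F 1) 1 / 2, coeff (coeff F 2) 0]"

lemma qvec_quad: "qvec (quad a b c) = vector [a, b, c]"
  by (simp add: qvec_def quad_def numeral_2_eq_2)

lemma binary_form_quad: "binary_form 2 (quad a b c)"
  by (auto simp: binary_form_def quad_def coeff_pCons numeral_eq_Suc split: nat.splits)

lemma binary_form_quart: "binary_form 4 (quart a b c d e)"
  by (auto simp: binary_form_def quart_def coeff_pCons numeral_eq_Suc split: nat.splits)

lemma binary_form_cub: "binary_form 3 (cub a b c d)"
  by (auto simp: binary_form_def cub_def coeff_pCons numeral_eq_Suc split: nat.splits)

lemma binary_form_3_cub:
  assumes "binary_form 3 (f :: 'a::field_char_0 poly poly)"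
  shows "\<exists>a b c d. f = cub a b c d"
proof -
  have z: "coeff (coeff f l) m = 0" if "l + m \<noteq> 3" for l m
    using assms that unfolding binary_form_def by blast
  have "coeff (coeff f l) m =
    coeff (coeff (cub (coeff (coeff f 0) 3) (coeff (coeff f 1) 2) (coeff (coeff f 2) 1)
                      (coeff (coeff f 3) 0)) l) m"
    for l m
    unfolding cub_def using z by (auto simp: coeff_pCons numeral_eq_Suc split: nat.splits)
  then show ?thesis by (metis poly_eqI)
qed

definition cov_mat :: "'a::field_char_0 poly poly \<Rightarrow> 'a poly poly \<Rightarrow> 'a ^ 3 ^ 3"
  where "cov_mat f g = (\<chi> r. qvec (covs f g $ r))"

lemma cst_mult_quad: "cst s * quad a b c = quad (s * a) (s * b) (s * c)"
  by (simp add: quad_def cst_def)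

lemma cst_mult_quart: "cst s * quart a b c d e = quart (s * a) (s * b) (s * c) (s * d) (s * e)"
  by (simp add: quart_def cst_def)

lemma transvectant_quart_quart_1:
  fixes p :: "'a::field_char_0"
  shows "transvectant 4 4 1 (quart p q r s t) (quart p' q' r' s' t') =
    [:[:0, 0, 0, 0, 0, 0, p * q' - q * p':],
      [:0, 0, 0, 0, 0, 3 * (p * r' - r * p'):],
      [:0, 0, 0, 0, 3 * (p * s' - s * p') + 6 * (q * r' - r * q'):],
      [:0, 0, 0, (p * t' - t * p') + 8 * (q * s' - s * q'):],
      [:0, 0, 3 * (q * t' - t * q') + 6 * (r * s' - s * r'):],
      [:0, 3 * (r * t' - t * r'):],
      [:s * t' - t * s':]:]"
  unfolding transvectant_def quart_def
  by (simp add: eval_nat_numeral fact_numeral D_pCons pderiv_pCons of_nat_poly cst_def)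
     (simp add: field_simps)?

lemma sextic_cube_pairing:
  fixes y0 :: "'a::field_char_0"
  shows "transvectant 6 6 6
    [:[:0, 0, 0, 0, 0, 0, y0:], [:0, 0, 0, 0, 0, y1:], [:0, 0, 0, 0, y2:], [:0, 0, 0, y3:],
      [:0, 0, y4:], [:0, y5:], [:y6:]:]
    [:[:0, 0, 0, 0, 0, 0, z0:], [:0, 0, 0, 0, 0, z1:], [:0, 0, 0, 0, z2:], [:0, 0, 0, z3:],
      [:0, 0, z4:], [:0, z5:], [:z6:]:] =
    cst (y0 * z6 - y1 * z5 / 6 + y2 * z4 / 15 - y3 * z3 / 20 + y4 * z2 / 15 - y5 * z1 / 6
      + y6 * z0)"
  unfolding transvectant_def
  by (simp add: eval_nat_numeral fact_numeral D_pCons pderiv_pCons of_nat_poly cst_def)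
     (simp add: field_simps)?

lemma quad_cube:
  "quad a b c ^ 3 = [:[:0, 0, 0, 0, 0, 0, a^3:], [:0, 0, 0, 0, 0, 6 * a^2 * b:],
     [:0, 0, 0, 0, 12 * a * b^2 + 3 * a^2 * c:], [:0, 0, 0, 8 * b^3 + 12 * a * b * c:],
      [:0, 0, 12 * b^2 * c + 3 * a * c^2:], [:0, 6 * b * c^2:], [:c^3:]:]"
  by (simp add: quad_def eval_nat_numeral algebra_simps)

text \<open>
  The link between the joint invariant of degree 6 and the three quadratic covariants: \<open>c \<noteq> 0\<close> says
  that these are linearly independent. It is an identity between polynomials in the eight
  coefficients of \<open>f\<close> and \<open>g\<close>.
\<close>

lemma w_c_cov_mat:
  fixes f g :: "'a::field_char_0 poly poly"
  assumes "binary_form 2 f" "binary_form 4 g"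
  shows "w_c (invariants f g) = det (cov_mat f g)"
proof -
  obtain a b c where f: "f = quad a b c" using binary_form_2_quad assms by blast
  obtain p q r s t where g: "g = quart p q r s t" using binary_form_4_quart assms by blast
  show ?thesis
    unfolding f g invariants_def cov_T_def cov_H_def cov_mat_def covs_def det_3 wcoords.sel
      transvectant_quart_quart_1 transvectant_quart_quart_2 quad_cube sextic_cube_pairing
      form_const_cst transvectant_quart_quad vec_lambda_beta vector_3 qvec_quad
    by (simp add: sextic_cube_pairing form_const_cst)
      (simp add: field_simps power2_eq_square power3_eq_cube)
qed

lemma quad_eq_iff: "quad a b c = quad a' b' c' \<longleftrightarrow> a = a' \<and> b = b' \<and> c = c'"
  by (auto simp: quad_def)

lemma quart_eq_iff:
  "quart a b c d e = quart a' b' c' d' e' \<longleftrightarrow> a = a' \<and> b = b' \<and> c = c' \<and> d = d' \<and> e = e'"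
  by (auto simp: quart_def)

lemma cub_eq_iff: "cub a b c d = cub a' b' c' d' \<longleftrightarrow> a = a' \<and> b = b' \<and> c = c' \<and> d = d'"
  by (auto simp: cub_def)

lemma cst_mult_cub: "cst s * cub a b c d = cub (s * a) (s * b) (s * c) (s * d)"
  by (simp add: cub_def cst_def)

lemma add_cub: "cub a b c d + cub a' b' c' d' = cub (a + a') (b + b') (c + c') (d + d')"
  by (simp add: cub_def)

section \<open>Invariants under scaling and substitution\<close>

lemma transvectant_cst:
  "transvectant m n r (cst s * F) (cst t * G) = cst (s * t) * transvectant m n r F G"
proof -
  have "D0 (cst s * F) = cst s * D0 F" "D1 (cst s * F) = cst s * D1 F" for s and F :: "'a poly poly"
    by (auto simp: D0_def D1_def cst_def coeff_map_poly pderiv_smult intro!: poly_eqI)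
  then have D: "(D0 ^^ k) (cst s * F) = cst s * (D0 ^^ k) F"
    "(D1 ^^ k) (cst s * F) = cst s * (D1 ^^ k) F"
    for k s and F :: "'a poly poly"
    by (induction k) simp_all
  show ?thesis
    unfolding transvectant_def D cst_hom(4) sum_distrib_left
    by (intro sum.cong refl) (simp add: algebra_simps)
qed

lemma transvectant_cst':
  "transvectant m n r (cst s * F) G = cst s * transvectant m n r F G"
  "transvectant m n r F (cst t * G) = cst t * transvectant m n r F G"
  using transvectant_cst[of m n r s F 1 G] transvectant_cst[of m n r 1 F t G]
  by (simp_all add: cst_hom)

lemma cov_H_cst: "cov_H (cst s * g) = cst (s ^ 2) * cov_H g"
  by (simp add: cov_H_def transvectant_cst power2_eq_square)

text \<open>
  Transvectants are covariants: \<open>(F, G)\<^sub>r\<close> picks up the factor \<open>(det M)\<^sup>r\<close>. For the orders at hand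
  each case is an identity between polynomials in the coefficients of the forms and the four entries
  of \<open>M\<close>.
\<close>

context
  fixes M :: "'a::field_char_0 ^ 2 ^ 2" and k l m n \<delta> :: 'a
  assumes M: "M $ 1 $ 1 = k" "M $ 1 $ 2 = l" "M $ 2 $ 1 = m" "M $ 2 $ 2 = n"
    and det: "\<delta> = k * n - l * m"
begin

lemmas lin_subst_coords = quad_quart_simps lin_subst_quad_coords[OF M]
    lin_subst_quart_coords[OF M] cst_mult_quad cst_mult_quart quad_eq_iff quart_eq_iff det
    cst_hom(4)[symmetric] cst_eq_iff

lemma lin_subst_22:
  assumes "f = quad a b c" "f' = quad a' b' c'"
  shows "transvectant 2 2 2 (lin_subst M f) (lin_subst M f') =
    cst (\<delta> ^ 2) * transvectant 2 2 2 f f'"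
  unfolding assms lin_subst_coords by Groebner_Basis.algebra

lemma lin_subst_42:
  assumes "g = quart p q r s t" "f = quad a b c"
  shows "transvectant 4 2 2 (lin_subst M g) (lin_subst M f) =
    cst (\<delta> ^ 2) * lin_subst M (transvectant 4 2 2 g f)"
  unfolding assms lin_subst_coords by (intro conjI; Groebner_Basis.algebra)

lemma lin_subst_44:
  assumes "g = quart p q r s t" "g' = quart p' q' r' s' t'"
  shows "transvectant 4 4 4 (lin_subst M g) (lin_subst M g') =
    cst (\<delta> ^ 4) * transvectant 4 4 4 g g'"
  unfolding assms lin_subst_coords by (simp add: eval_nat_numeral algebra_simps)

lemma lin_subst_H:
  assumes "g = quart p q r s t"
  shows "cov_H (lin_subst M g) = cst (\<delta> ^ 2) * lin_subst M (cov_H g)"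
  unfolding assms lin_subst_coords cov_H_def
  by (intro conjI)
    (simp_all add: eval_nat_numeral algebra_simps add_divide_distrib diff_divide_distrib)

end

lemma transvectant_lin_subst:
  fixes f f' g g' :: "'a::field_char_0 poly poly" and M :: "'a ^ 2 ^ 2"
  shows "binary_form 2 f \<Longrightarrow> binary_form 2 f' \<Longrightarrow>
      transvectant 2 2 2 (lin_subst M f) (lin_subst M f') =
      cst (det M ^ 2) * transvectant 2 2 2 f f'"
    "binary_form 4 g \<Longrightarrow> binary_form 2 f \<Longrightarrow>
      transvectant 4 2 2 (lin_subst M g) (lin_subst M f) =
      cst (det M ^ 2) * lin_subst M (transvectant 4 2 2 g f)"
    "binary_form 4 g \<Longrightarrow> binary_form 4 g' \<Longrightarrow>
      transvectant 4 4 4 (lin_subst M g) (lin_subst M g') =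
      cst (det M ^ 4) * transvectant 4 4 4 g g'"
    "binary_form 4 g \<Longrightarrow> cov_H (lin_subst M g) = cst (det M ^ 2) * lin_subst M (cov_H g)"
  using binary_form_4_quart[of g]
  by (auto dest!: binary_form_2_quad binary_form_4_quart
      intro!: lin_subst_22[OF refl refl refl refl det_2 refl refl]
        lin_subst_42[OF refl refl refl refl det_2 refl refl]
        lin_subst_44[OF refl refl refl refl det_2 refl refl]
        lin_subst_H[OF refl refl refl refl det_2 refl])

lemma form_const_cst_mult: "form_const (cst s * F) = s * form_const F"
  by (simp add: form_const_def cst_def)

lemma binary_form_ops:
  fixes f g :: "'a::field_char_0 poly poly"
  shows "binary_form 2 f \<Longrightarrow> binary_form 2 (lin_subst M f)"
    "binary_form 4 g \<Longrightarrow> binary_form 4 (lin_subst M g)"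
    "binary_form 2 f \<Longrightarrow> binary_form 2 (cst s * f)"
    "binary_form 4 g \<Longrightarrow> binary_form 4 (cst s * g)"
    "binary_form 4 g \<Longrightarrow> binary_form 4 (cov_H g)"
    "binary_form 4 g \<Longrightarrow> binary_form 2 f \<Longrightarrow> binary_form 2 (transvectant 4 2 2 g f)"
    "binary_form 2 f \<Longrightarrow> binary_form 4 (f * f)"
  by (auto dest!: binary_form_2_quad binary_form_4_quart simp: cst_mult_quad cst_mult_quart cov_H_def
    quad_quart_simps binary_form_quad binary_form_quart lin_subst_quad_coords[OF refl refl refl refl]
    lin_subst_quart_coords[OF refl refl refl refl])

lemma binary_form_covs:
  assumes "binary_form 2 f" "binary_form 4 g"
  shows "binary_form 2 (covs f g $ r)"
proof -
  have "\<forall>r. binary_form 2 (covs f g $ r)"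
    using assms by (simp add: forall_3 covs_def binary_form_ops)
  then show ?thesis ..
qed

lemma invariants_eq:
  fixes f g :: "'a::field_char_0 poly poly"
  assumes f: "binary_form 2 f" and g: "binary_form 4 g"
  shows "invariants f g = WCoords
    (form_const (transvectant 2 2 2 f f))
    (form_const (transvectant 4 4 4 g g))
    (form_const (transvectant 4 4 4 (cov_H g) g))
    (form_const (transvectant 4 4 4 g (f * f)))
    (form_const (transvectant 4 4 4 (cov_H g) (f * f)))
    (det (cov_mat f g))"
  using w_c_cov_mat[OF f g] by (simp add: invariants_def power2_eq_square)

lemma invariants_scale:
  fixes f g :: "'a::field_char_0 poly poly"
  assumes f: "binary_form 2 f" and g: "binary_form 4 g"
  shows "invariants (cst s * f) (cst t * g) = (case invariants f g of WCoords d i j a b c \<Rightarrow>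
    WCoords (s^2 * d) (t^2 * i) (t^3 * j) (s^2 * t * a) (s^2 * t^2 * b) (s^3 * t^3 * c))"
proof -
  note bf = f g binary_form_ops
  have ff: "cst s * f * (cst s * f) = cst (s * s) * (f * f)" by (simp add: cst_hom)
  obtain a1 b1 c1 where u1: "f = quad a1 b1 c1" using binary_form_2_quad[OF f] by blast
  obtain a2 b2 c2 where u2: "transvectant 4 2 2 g f = quad a2 b2 c2"
    using binary_form_2_quad[OF binary_form_ops(6)[OF g f]] by blast
  obtain a3 b3 c3 where u3: "transvectant 4 2 2 (cov_H g) f = quad a3 b3 c3"
    using binary_form_2_quad[OF binary_form_ops(6)[OF binary_form_ops(5)[OF g] f]] by blast
  have "det (cov_mat (cst s * f) (cst t * g)) = s^3 * t^3 * det (cov_mat f g)"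
    unfolding cov_mat_def covs_def det_3 vec_lambda_beta vector_3 transvectant_cst cov_H_cst u2 u3
    unfolding u1 cst_mult_quad qvec_quad vector_3 by Groebner_Basis.algebra
  then show ?thesis
    by (simp add: invariants_eq bf transvectant_cst cov_H_cst form_const_cst_mult ff)
       (simp add: algebra_simps power2_eq_square power3_eq_cube)
qed

text \<open>
  The symmetric square of \<open>M\<close> has determinant \<open>(det M)\<^sup>3\<close>.
\<close>

lemma det_qvec_lin_subst:
  fixes M :: "'a::field_char_0 ^ 2 ^ 2"
  assumes "binary_form 2 u1" "binary_form 2 u2" "binary_form 2 u3"
  shows "det (vector [qvec (lin_subst M u1), qvec (lin_subst M u2), qvec (lin_subst M u3)]
      :: 'a ^ 3 ^ 3) =
    det M ^ 3 * det (vector [qvec u1, qvec u2, qvec u3] :: 'a ^ 3 ^ 3)"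
proof -
  obtain a1 b1 c1 where u1: "u1 = quad a1 b1 c1" using binary_form_2_quad assms by blast
  obtain a2 b2 c2 where u2: "u2 = quad a2 b2 c2" using binary_form_2_quad assms by blast
  obtain a3 b3 c3 where u3: "u3 = quad a3 b3 c3" using binary_form_2_quad assms by blast
  define k l m n where "k = M $ 1 $ 1" and "l = M $ 1 $ 2" and "m = M $ 2 $ 1" and "n = M $ 2 $ 2"
  have M: "M $ 1 $ 1 = k" "M $ 1 $ 2 = l" "M $ 2 $ 1 = m" "M $ 2 $ 2 = n" 
    by (simp_all add: k_def l_def m_def n_def)
  show ?thesis
    unfolding u1 u2 u3 lin_subst_quad_coords[OF M] qvec_quad det_3 det_2 vector_3 M
    by Groebner_Basis.algebra
qed

text \<open>
  Each exponent is half the sum of the orders of all factors \<open>f\<close> and \<open>g\<close> in the invariant, for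
  example \<open>(3 * 4 + 3 * 2) / 2 = 9\<close> for \<open>c\<close>, which is cubic in both \<open>g\<close> and \<open>f\<close>.
\<close>

lemma invariants_lin_subst:
  fixes f g :: "'a::field_char_0 poly poly"
  assumes f: "binary_form 2 f" and g: "binary_form 4 g"
  shows "invariants (lin_subst M f) (lin_subst M g) = (case invariants f g of WCoords d i j a b c \<Rightarrow>
    WCoords (det M ^ 2 * d) (det M ^ 4 * i) (det M ^ 6 * j)
      (det M ^ 4 * a) (det M ^ 6 * b) (det M ^ 9 * c))"
proof -
  note bf = f g binary_form_ops
  define \<delta> where "\<delta> = det M"
  note L = transvectant_lin_subst[where M = M, folded \<delta>_def]
  define u2 where "u2 = transvectant 4 2 2 g f"
  define u3 where "u3 = transvectant 4 2 2 (cov_H g) f"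
  have bu: "binary_form 2 u2" "binary_form 2 u3" by (simp_all add: u2_def u3_def bf)
  have ff: "lin_subst M f * lin_subst M f = lin_subst M (f * f)" by (simp add: lin_subst_hom)
  have L2: "transvectant 4 2 2 (lin_subst M g) (lin_subst M f) = cst (\<delta>^2) * lin_subst M u2"
    by (simp add: L bf u2_def)
  have L3: "transvectant 4 2 2 (cov_H (lin_subst M g)) (lin_subst M f) = cst (\<delta>^4) * lin_subst M u3"
  proof -
    have "cst (\<delta> ^ 4) = cst (\<delta>\<^sup>2) * cst (\<delta>\<^sup>2)" by (simp flip: cst_hom(4) power_add)
    then show ?thesis by (simp add: L bf u3_def transvectant_cst' mult.assoc)
  qed
  obtain a1 b1 c1 where v1: "lin_subst M f = quad a1 b1 c1"
    using binary_form_2_quad[OF binary_form_ops(1)[OF f]] by blast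
  obtain a2 b2 c2 where v2: "lin_subst M u2 = quad a2 b2 c2"
    using binary_form_2_quad[OF binary_form_ops(1)[OF bu(1)]] by blast
  obtain a3 b3 c3 where v3: "lin_subst M u3 = quad a3 b3 c3"
    using binary_form_2_quad[OF binary_form_ops(1)[OF bu(2)]] by blast
  have "det (cov_mat (lin_subst M f) (lin_subst M g)) = \<delta> ^ 6 *
    det (vector [qvec (lin_subst M f), qvec (lin_subst M u2), qvec (lin_subst M u3)] :: 'a ^ 3 ^ 3)"
    unfolding cov_mat_def covs_def det_3 vec_lambda_beta vector_3 L2 L3
    unfolding v1 v2 v3 cst_mult_quad qvec_quad vector_3 by Groebner_Basis.algebra
  also have "\<dots> = \<delta> ^ 9 * det (cov_mat f g)"
    unfolding det_qvec_lin_subst[OF f bu]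
    by (simp add: cov_mat_def covs_def det_3 u2_def u3_def \<delta>_def[symmetric]) 
  finally have 1: "det (cov_mat (lin_subst M f) (lin_subst M g)) = \<delta> ^ 9 * det (cov_mat f g)" .
  show ?thesis
    by (simp add: invariants_eq bf L transvectant_cst transvectant_cst' form_const_cst_mult ff 1
        \<delta>_def[symmetric] flip: power_add)
qed

section \<open>Cubic maps and pairs of forms\<close>

lemma map_f_cub: "map_f (cub a b c d) (cub a' b' c' d') = quad (3 * a + b') (b + c') (c + 3 * d')"
  by (simp add: map_f_def cub_def quad_def D_pCons pderiv_pCons numeral_poly)

lemma map_g_cub: "map_g (cub a b c d) (cub a' b' c' d') =
  quart (- a') ((a - b') / 4) ((b - c') / 6) ((c - d') / 4) d"
  by (simp add: map_g_def cub_def quart_def X0_def X1_def)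

lemma binary_form_map:
  assumes "cubic_map F0 F1"
  shows "binary_form 2 (map_f F0 F1)" "binary_form 4 (map_g F0 F1)"
  using assms unfolding cubic_map_def
  by (auto dest!: binary_form_3_cub simp: map_f_cub map_g_cub binary_form_quad binary_form_quart)

text \<open>
  \<open>F\<^sub>0 = (\<partial>g/\<partial>X\<^sub>1 + X\<^sub>0 f) / 4\<close> and \<open>F\<^sub>1 = (X\<^sub>1 f - \<partial>g/\<partial>X\<^sub>0) / 4\<close>; on coefficients the two maps give a
  linear system with this solution.
\<close>

lemma map_f_g_inject:
  assumes "binary_form 3 F0" "binary_form 3 F1" "binary_form 3 G0" "binary_form 3 G1"
    and "map_f F0 F1 = map_f G0 G1" "map_g F0 F1 = map_g G0 G1"
  shows "F0 = G0" "F1 = G1"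
proof -
  obtain a b c d where 1: "F0 = cub a b c d" using binary_form_3_cub assms by blast
  obtain a' b' c' d' where 2: "F1 = cub a' b' c' d'" using binary_form_3_cub assms by blast
  obtain p q r s where 3: "G0 = cub p q r s" using binary_form_3_cub assms by blast
  obtain p' q' r' s' where 4: "G1 = cub p' q' r' s'" using binary_form_3_cub assms by blast
  have e: "3 * a + b' = 3 * p + q'" "(a - b') / 4 = (p - q') / 4" "b + c' = q + r'"
    "(b - c') / 6 = (q - r') / 6" "c + 3 * d' = r + 3 * s'" "(c - d') / 4 = (r - s') / 4"
    "d = s" "- a' = - p'"
    using assms(5,6) unfolding 1 2 3 4 map_f_cub map_g_cub quad_eq_iff quart_eq_iff by blast+
  have cancel: "u = v" if "u / w = v / w" "w \<noteq> 0" for u v w :: 'a using that by simp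
  have e': "a - b' = p - q'" "b - c' = q - r'" "c - d' = r - s'"
    using cancel[OF e(2)] cancel[OF e(4)] cancel[OF e(6)] by simp_all
  have "16 * a = 16 * p" "16 * b' = 16 * q'" "12 * b = 12 * q" "12 * c' = 12 * r'"
    "16 * d' = 16 * s'" "16 * c = 16 * r"
    using e(1,3,5) e' by Groebner_Basis.algebra+
  then have "a = p" "b' = q'" "b = q" "c' = r'" "d' = s'" "c = r" by simp_all
  then show "F0 = G0" "F1 = G1" using e(7,8) by (auto simp: 1 2 3 4 cub_eq_iff)
qed

lemma map_scale:
  "map_f (cst s * F0) (cst s * F1) = cst s * map_f F0 F1"
  "map_g (cst s * F0) (cst s * F1) = cst s * map_g F0 F1"
proof -
  have "D0 (cst s * F) = cst s * D0 F" "D1 (cst s * F) = cst s * D1 F" for F :: "'a poly poly"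
    by (auto simp: D0_def D1_def cst_def coeff_map_poly pderiv_smult intro!: poly_eqI)
  then show "map_f (cst s * F0) (cst s * F1) = cst s * map_f F0 F1"
    "map_g (cst s * F0) (cst s * F1) = cst s * map_g F0 F1"
    by (simp_all add: map_f_def map_g_def algebra_simps)
qed

lemma lin_subst_cub_coords:
  fixes M :: "'a::field_char_0 ^ 2 ^ 2"
  assumes "M $ 1 $ 1 = k" "M $ 1 $ 2 = l" "M $ 2 $ 1 = m" "M $ 2 $ 2 = n"
  shows "lin_subst M (cub p q r s) = cub
    (p*k^3 + q*k^2*m + r*k*m^2 + s * m^3)
    (3*p*k^2*l + q*(k^2*n + 2*k*l*m) + r*(2*k*m*n + l*m^2) + 3 * s * m^2*n)
    (3*p*k*l^2 + q*(l^2*m + 2*k*l*n) + r*(2*l*m*n + k*n^2) + 3 * s * m*n^2)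
    (p*l^3 + q*l^2*n + r*l*n^2 + s * n^3)"
  unfolding lin_subst_cub lin_form_def assms unfolding cub_eq cst_hom by Groebner_Basis.algebra

lemma matrix_inv_2:
  fixes M :: "'a::field_char_0 ^ 2 ^ 2"
  assumes "det M \<noteq> 0"
  shows "det M * matrix_inv M $ 1 $ 1 = M $ 2 $ 2" "det M * matrix_inv M $ 1 $ 2 = - M $ 1 $ 2"
    "det M * matrix_inv M $ 2 $ 1 = - M $ 2 $ 1" "det M * matrix_inv M $ 2 $ 2 = M $ 1 $ 1"
    "matrix_inv M ** M = mat 1" "M ** matrix_inv M = mat 1"
proof -
  have "invertible M" using assms by (simp add: invertible_det_nz)
  then show 1: "matrix_inv M ** M = mat 1" "M ** matrix_inv M = mat 1"
    unfolding invertible_def matrix_inv_def by (metis (mono_tags, lifting) someI_ex)+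
  define N where "N = matrix_inv M"
  have "\<forall>r s. (N ** M) $ r $ s = mat 1 $ r $ s" using 1 by (simp add: N_def)
  then have "N $ 1 $ 1 * M $ 1 $ 1 + N $ 1 $ 2 * M $ 2 $ 1 = 1"
    "N $ 1 $ 1 * M $ 1 $ 2 + N $ 1 $ 2 * M $ 2 $ 2 = 0"
    "N $ 2 $ 1 * M $ 1 $ 1 + N $ 2 $ 2 * M $ 2 $ 1 = 0"
    "N $ 2 $ 1 * M $ 1 $ 2 + N $ 2 $ 2 * M $ 2 $ 2 = 1"
    by (auto simp: forall_2 matrix_matrix_mult_def sum_2 mat_def)
  then show "det M * matrix_inv M $ 1 $ 1 = M $ 2 $ 2" "det M * matrix_inv M $ 1 $ 2 = - M $ 1 $ 2"
    "det M * matrix_inv M $ 2 $ 1 = - M $ 2 $ 1" "det M * matrix_inv M $ 2 $ 2 = M $ 1 $ 1"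
    unfolding det_2 N_def[symmetric] by Groebner_Basis.algebra+
qed

text \<open>
  The form \<open>f\<close> is the divergence of the vector field \<open>(F\<^sub>0, F\<^sub>1)\<close> and \<open>g\<close> is the determinant of
  \<open>(F\<^sub>0, F\<^sub>1)\<close> and \<open>(X\<^sub>0, X\<^sub>1)\<close>. Conjugation is the linear change of coordinates for vector fields,
  which leaves the divergence alone and divides the determinant by \<open>det M\<close>.
\<close>

lemma conj_map_forms:
  fixes M :: "'a::field_char_0 ^ 2 ^ 2"
  assumes M: "det M \<noteq> 0" and F: "binary_form 3 F0" "binary_form 3 F1"
    and G: "conj_map M (F0, F1) = (G0, G1)"
  shows "binary_form 3 G0" "binary_form 3 G1"
    "map_f G0 G1 = lin_subst M (map_f F0 F1)"
    "map_g G0 G1 = cst (1 / det M) * lin_subst M (map_g F0 F1)"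
proof -
  define N where "N = matrix_inv M"
  define k l m n where "k = M $ 1 $ 1" and "l = M $ 1 $ 2" and "m = M $ 2 $ 1" and "n = M $ 2 $ 2"
  have kl: "M $ 1 $ 1 = k" "M $ 1 $ 2 = l" "M $ 2 $ 1 = m" "M $ 2 $ 2 = n"
    by (simp_all add: k_def l_def m_def n_def)
  define \<delta> where "\<delta> = det M"
  have \<delta>: "\<delta> = k * n - l * m" "\<delta> \<noteq> 0" using M by (simp_all add: \<delta>_def det_2 kl)
  have N: "N $ 1 $ 1 = n / \<delta>" "N $ 1 $ 2 = - l / \<delta>" "N $ 2 $ 1 = - m / \<delta>" "N $ 2 $ 2 = k / \<delta>"
    using matrix_inv_2[OF M, folded \<delta>_def N_def] \<delta>(2) by (simp_all add: kl field_simps)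
  define H0 where "H0 = lin_subst M F0"
  define H1 where "H1 = lin_subst M F1"
  have G0: "G0 = cst (1 / \<delta>) * (cst n * H0 + cst (- l) * H1)"
    and G1: "G1 = cst (1 / \<delta>) * (cst (- m) * H0 + cst k * H1)"
    using G by (simp_all add: conj_map_def Let_def flip: N_def H0_def H1_def)
      (simp_all add: N field_simps flip: cst_hom(4))
  obtain a b c d where 1: "F0 = cub a b c d" using binary_form_3_cub F by blast
  obtain a' b' c' d' where 2: "F1 = cub a' b' c' d'" using binary_form_3_cub F by blast
  show "binary_form 3 G0" "binary_form 3 G1"
    unfolding G0 G1 H0_def H1_def 1 2 lin_subst_cub_coords[OF kl] cst_mult_cub add_cub
    by (rule binary_form_cub)+
  have f: "map_f (cst n * H0 + cst (- l) * H1) (cst (- m) * H0 + cst k * H1) =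
    cst \<delta> * lin_subst M (map_f F0 F1)"
    unfolding H0_def H1_def 1 2 lin_subst_cub_coords[OF kl] cst_mult_cub add_cub map_f_cub
      lin_subst_quad_coords[OF kl] cst_mult_quad quad_eq_iff \<delta>(1)
    by (intro conjI; Groebner_Basis.algebra)
  have c1: "cst (1 / \<delta>) * cst \<delta> = 1" using \<delta>(2) by (simp flip: cst_hom(4)) (simp add: cst_hom)
  show "map_f G0 G1 = lin_subst M (map_f F0 F1)"
    unfolding G0 G1 map_scale f mult.assoc[symmetric] c1 by simp
  have "map_g (cst n * H0 + cst (- l) * H1) (cst (- m) * H0 + cst k * H1) =
    lin_form M 2 * H0 - lin_form M 1 * H1"
    by (simp add: map_g_def lin_form_def kl cst_hom algebra_simps)
  also have "\<dots> = lin_subst M (map_g F0 F1)"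
    by (simp add: map_g_def lin_subst_hom H0_def H1_def)
  finally show "map_g G0 G1 = cst (1 / det M) * lin_subst M (map_g F0 F1)"
    unfolding G0 G1 map_scale \<delta>_def by simp
qed

text \<open>
  The substitution by \<open>M\<close> is a ring automorphism and the inverse of \<open>M\<close> recombines the components
  invertibly, so common divisors before and after the conjugation correspond to each other.
\<close>

lemma coprime_conj_map:
  fixes M :: "'a::field_char_0 ^ 2 ^ 2"
  assumes M: "det M \<noteq> 0" and F: "coprime F0 F1" and G: "conj_map M (F0, F1) = (G0, G1)"
  shows "coprime G0 G1"
proof (rule coprimeI)
  fix D assume D: "D dvd G0" "D dvd G1"
  define N where "N = matrix_inv M"
  have NM: "M ** N = mat 1" "N ** M = mat 1" using matrix_inv_2[OF M] by (simp_all add: N_def)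
  define H0 where "H0 = lin_subst M F0"
  define H1 where "H1 = lin_subst M F1"
  have G': "cst (N $ 1 $ 1) * H0 + cst (N $ 1 $ 2) * H1 = G0"
    "cst (N $ 2 $ 1) * H0 + cst (N $ 2 $ 2) * H1 = G1"
    using G by (simp_all add: conj_map_def Let_def H0_def H1_def N_def)
  have "\<forall>r s. (M ** N) $ r $ s = mat 1 $ r $ s" using NM by simp
  then have MN: "M $ 1 $ 1 * N $ 1 $ 1 + M $ 1 $ 2 * N $ 2 $ 1 = 1"
    "M $ 1 $ 1 * N $ 1 $ 2 + M $ 1 $ 2 * N $ 2 $ 2 = 0"
    "M $ 2 $ 1 * N $ 1 $ 1 + M $ 2 $ 2 * N $ 2 $ 1 = 0"
    "M $ 2 $ 1 * N $ 1 $ 2 + M $ 2 $ 2 * N $ 2 $ 2 = 1"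
    by (auto simp: forall_2 matrix_matrix_mult_def sum_2 mat_def)
  have comb: "cst (M $ r $ 1) * G0 + cst (M $ r $ 2) * G1 =
    cst (M $ r $ 1 * N $ 1 $ 1 + M $ r $ 2 * N $ 2 $ 1) * H0 +
    cst (M $ r $ 1 * N $ 1 $ 2 + M $ r $ 2 * N $ 2 $ 2) * H1" for r
    unfolding G'[symmetric] by (simp add: cst_hom algebra_simps)
  have "D dvd H0" "D dvd H1"
    using comb[of 1] comb[of 2] D unfolding MN by (simp_all add: cst_hom) (metis dvd_add dvd_mult)+
  then have "lin_subst N D dvd F0" "lin_subst N D dvd F1"
    unfolding H0_def H1_def
    by (metis NM(1) dvd_def lin_subst_compose lin_subst_hom(3) lin_subst_id)+
  then have "lin_subst N D dvd 1" using F by (rule coprime_common_divisor[rotated])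
  then show "is_unit D"
    by (metis NM(2) dvd_def lin_subst_compose lin_subst_hom(3,7) lin_subst_id)
qed

lemma cubic_map_scale:
  assumes "cubic_map F0 F1" "s \<noteq> 0"
  shows "cubic_map (cst s * F0) (cst s * F1)"
proof -
  have u: "is_unit (cst s)"
    using assms(2) by (intro dvdI[of _ _ "cst (1 / s)"]) (simp add: cst_hom flip: cst_hom(4))
  show ?thesis
    using assms(1) u unfolding cubic_map_def
    by (auto dest!: binary_form_3_cub simp: cst_mult_cub binary_form_cub coprime_mult_left_iff
        coprime_mult_right_iff is_unit_left_imp_coprime is_unit_right_imp_coprime)
qed

text \<open>
  The pairs of forms that come from cubic maps are stable under substitution, up to the indicated
  factors. In particular \<open>f \<circ> M / det M\<close> and \<open>g \<circ> M / (det M)\<^sup>2\<close> come from a cubic map again; this is the case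
  \<open>s = 1 / det M\<close>.
\<close>

lemma model_lin_subst:
  assumes F: "cubic_map F0 F1" and M: "det M \<noteq> 0" and s: "s \<noteq> 0"
  shows "\<exists>G0 G1. cubic_map G0 G1 \<and> map_f G0 G1 = cst s * lin_subst M (map_f F0 F1) \<and>
    map_g G0 G1 = cst (s / det M) * lin_subst M (map_g F0 F1)"
proof -
  obtain G0 G1 where G: "conj_map M (F0, F1) = (G0, G1)" by fastforce
  have bf: "binary_form 3 F0" "binary_form 3 F1" and c: "coprime F0 F1"
    using F by (simp_all add: cubic_map_def)
  note C = conj_map_forms[OF M bf G]
  have "cubic_map G0 G1" using C coprime_conj_map[OF M c G] by (simp add: cubic_map_def)
  then have "cubic_map (cst s * G0) (cst s * G1)" using s by (rule cubic_map_scale)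
  moreover have "cst s * (cst (1 / det M) * H) = cst (s / det M) * H" for H
    by (simp flip: cst_hom(4) mult.assoc)
  ultimately show ?thesis
    by (intro exI[of _ "cst s * G0"] exI[of _ "cst s * G1"]) (simp add: map_scale C)
qed

section \<open>Reconstruction of a pair from its invariants\<close>

lemma lin_form_products:
  fixes M :: "'a::field_char_0 ^ 2 ^ 2"
  assumes "M $ 1 $ 1 = k" "M $ 1 $ 2 = l" "M $ 2 $ 1 = m" "M $ 2 $ 2 = n"
  shows "lin_form M 1 ^ 2 = quad (k^2) (k * l) (l^2)" "lin_form M 2 ^ 2 = quad (m^2) (m * n) (n^2)"
    "- (lin_form M 1 * lin_form M 2) = quad (- (k * m)) (- (k * n + l * m) / 2) (- (l * n))"
proof -
  show "lin_form M 1 ^ 2 = quad (k^2) (k * l) (l^2)" "lin_form M 2 ^ 2 = quad (m^2) (m * n) (n^2)"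
    unfolding lin_form_def assms quad_eq cst_hom by Groebner_Basis.algebra+
  have "2 * cst (y / 2) = cst y" for y :: 'a
    using cst_hom(4)[of 2 "y / 2"] by (simp add: cst_hom(8))
  then show "- (lin_form M 1 * lin_form M 2) = quad (- (k * m)) (- (k * n + l * m) / 2) (- (l * n))"
    unfolding lin_form_def assms quad_eq by (simp add: cst_hom algebra_simps power2_eq_square)
qed

lemma qvec_add: "qvec (F + G) = qvec F + qvec G"
  by (simp add: qvec_def vec_eq_iff forall_3 add_divide_distrib)

lemma qvec_cst: "qvec (cst s * F) = s *s qvec F"
  by (simp add: qvec_def cst_def vec_eq_iff forall_3)

text \<open>
  Let \<open>P, Q, R\<close> be the three forms and \<open>w = (P, Q)\<^sub>1\<close>. Since \<open>w\<close> is orthogonal to \<open>P\<close> and \<open>Q\<close>, the pairing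
  \<open>(Q\<^sup>2, P w)\<^sub>4\<close> vanishes and \<open>(P R, P w)\<^sub>4\<close> reduces to a multiple of \<open>(P, P)\<^sub>2 (R, w)\<^sub>2\<close>. Here \<open>(R, w)\<^sub>2\<close> is the
  determinant of \<open>P, Q, R\<close> up to a constant, so \<open>P R = Q\<^sup>2\<close> makes the discriminant of \<open>P\<close> vanish.
\<close>

lemma disc_eq_0_of_prod_square:
  fixes p0 :: "'a::field_char_0"
  assumes "quad p0 p1 p2 * quad r0 r1 r2 = quad q0 q1 q2 * quad q0 q1 q2"
   and "det (vector [vector [p0, p1, p2], vector [q0, q1, q2], vector [r0, r1, r2]] :: 'a ^ 3 ^ 3) \<noteq> 0"
  shows "p1^2 = p0 * p2"
proof -
  \<comment> \<open>the product of \<open>P\<close> and the Jacobian \<open>(P, Q)\<^sub>1\<close>\<close>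
  define h where "h = quad p0 p1 p2 *
    quad (p0 * q1 - p1 * q0) ((p0 * q2 - p2 * q0) / 2) (p1 * q2 - p2 * q1)"
  have "form_const (transvectant 4 4 4 (quad p0 p1 p2 * quad r0 r1 r2) h) =
    form_const (transvectant 4 4 4 (quad q0 q1 q2 * quad q0 q1 q2) h)"
    unfolding assms ..
  \<comment> \<open>4608 is the factor that remains after clearing denominators\<close>
  then have "4608 * (p0 * p2 - p1 ^ 2) *
      det (vector [vector [p0, p1, p2], vector [q0, q1, q2], vector [r0, r1, r2]] :: 'a ^ 3 ^ 3) = 0"
    unfolding h_def quad_quart_simps det_3 vector_3 by (simp add: field_simps power2_eq_square)
  then show ?thesis using assms(2) by simp
qed

lemma quad_eq_square:
  fixes p0 :: "'a::{field_char_0, alg_closed_field}"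
  assumes "p1^2 = p0 * p2"
  shows "\<exists>l m. quad p0 p1 p2 = (cst l * X0 + cst m * X1) ^ 2"
proof -
  obtain l where l: "l ^ 2 = p0" using nth_root_exists[of 2 p0] by auto
  obtain m where m: "m ^ 2 = p2" using nth_root_exists[of 2 p2] by auto
  have "p1 ^ 2 = (l * m) ^ 2" using assms l m by (simp add: power_mult_distrib)
  then consider "p1 = l * m" | "p1 = l * (- m)" by (auto simp: power2_eq_iff)
  then show ?thesis
  proof cases
    case 1
    show ?thesis
      by (rule exI[of _ l], rule exI[of _ m])
        (simp add: quad_eq 1 l[symmetric] m[symmetric] cst_hom algebra_simps power2_eq_square)
  next
    case 2
    show ?thesis
      by (rule exI[of _ l], rule exI[of _ "- m"])
        (simp add: quad_eq 2 l[symmetric] m[symmetric] cst_hom algebra_simps power2_eq_square)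
  qed
qed

lemma covs_coords:
  assumes "binary_form 2 f" "binary_form 4 g"
  shows "covs f g $ r = quad (cov_mat f g $ r $ 1) (cov_mat f g $ r $ 2) (cov_mat f g $ r $ 3)"
  using binary_form_2_quad[OF binary_form_covs[OF assms, of r]]
  by (auto simp: cov_mat_def qvec_quad)

text \<open>
  Everything about the conic and the reconstruction formulas is computed in terms of the coefficient
  matrix \<open>U\<close> of the covariants: \<open>C\<close>, \<open>A\<close> and \<open>B\<close> are the values of \<open>(_, _)\<^sub>2\<close>, \<open>(f, _)\<^sub>2\<close> and \<open>(g, _ * _)\<^sub>4\<close> on its
  rows.
\<close>

context
  fixes f g :: "'a::field_char_0 poly poly" and U :: "'a ^ 3 ^ 3" and x :: "'a wcoords"
  assumes f: "binary_form 2 f" and g: "binary_form 4 g"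
  defines "U \<equiv> cov_mat f g" and "x \<equiv> invariants f g"
begin

lemma C_mat_cov_mat:
  "C_mat x $ r $ s = U $ r $ 1 * U $ s $ 3 - 2 * U $ r $ 2 * U $ s $ 2 + U $ r $ 3 * U $ s $ 1"
  unfolding x_def U_def C_mat_covariants[OF f g] covs_coords[OF f g] quad_quart_simps ..

lemma det_C_mat: "det (C_mat x) = 2 * w_c x ^ 2"
proof -
  have "w_c x = det U" using w_c_cov_mat[OF f g] by (simp add: x_def U_def)
  then show ?thesis unfolding det_3 C_mat_cov_mat by Groebner_Basis.algebra
qed

lemma A_vec_cov_mat:
  assumes "f = quad a b c"
  shows "A_vec x $ r = a * U $ r $ 3 - 2 * b * U $ r $ 2 + c * U $ r $ 1"
proof -
  have "\<forall>r. A_vec x $ r = C_mat x $ 1 $ r"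
    by (simp add: forall_3 A_vec_def C_mat_def split: wcoords.split)
  moreover have "U $ 1 = vector [a, b, c]"
    by (simp add: U_def cov_mat_def covs_def assms qvec_quad)
  ultimately show ?thesis by (simp add: C_mat_cov_mat)
qed

lemma B_mat_cov_mat:
  assumes "g = quart p q w t v"
  shows "B_mat x $ r $ s = p * U $ r $ 3 * U $ s $ 3
    - 2 * q * (U $ r $ 2 * U $ s $ 3 + U $ r $ 3 * U $ s $ 2)
    + w * (U $ r $ 1 * U $ s $ 3 + 4 * U $ r $ 2 * U $ s $ 2 + U $ r $ 3 * U $ s $ 1)
    - 2 * t * (U $ r $ 1 * U $ s $ 2 + U $ r $ 2 * U $ s $ 1) + v * U $ r $ 1 * U $ s $ 1"
  unfolding x_def B_mat_covariants[OF f g]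
  unfolding covs_coords[OF f g] U_def[symmetric]
  unfolding assms quad_quart_simps by (simp add: field_simps)

text \<open>
  \<open>S 1\<close>, \<open>S 2\<close>, \<open>S 3\<close> are the coordinates of the form \<open>\<Sum> \<theta>\<^sub>r u\<^sub>r\<close> in the variables of the \<open>u\<^sub>r\<close>; they are
  themselves forms in the variables of the \<open>\<theta>\<^sub>r\<close>. In these terms the equation of the conic is the vanishing of the discriminant.
\<close>

context
  fixes \<theta> :: "'a poly poly ^ 3" and S :: "3 \<Rightarrow> 'a poly poly"
  defines "S \<equiv> \<lambda>k. \<Sum>r\<in>UNIV. cst (U $ r $ k) * \<theta> $ r"
begin

lemma C_sum: "(\<Sum>r\<in>UNIV. \<Sum>s\<in>UNIV. cst (C_mat x $ r $ s) * \<theta> $ r * \<theta> $ s) =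
    2 * (S 1 * S 3 - S 2 ^ 2)"
  unfolding C_mat_cov_mat S_def sum_3 cst_hom by Groebner_Basis.algebra

lemma A_sum:
  assumes "f = quad a b c"
  shows "(\<Sum>r\<in>UNIV. cst (A_vec x $ r) * \<theta> $ r) = cst a * S 3 - 2 * cst b * S 2 + cst c * S 1"
  unfolding A_vec_cov_mat[OF assms] S_def sum_3 cst_hom by Groebner_Basis.algebra

lemma B_sum:
  assumes "g = quart p q w t v"
  shows "(\<Sum>r\<in>UNIV. \<Sum>s\<in>UNIV. cst (B_mat x $ r $ s) * \<theta> $ r * \<theta> $ s) =
    cst p * S 3 ^ 2 - 4 * cst q * (S 2 * S 3) + cst w * (2 * S 1 * S 3 + 4 * S 2 ^ 2)
      - 4 * cst t * (S 1 * S 2) + cst v * S 1 ^ 2"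
  unfolding B_mat_cov_mat[OF assms] S_def sum_3 cst_hom by Groebner_Basis.algebra

lemma qvec_S: "qvec (S k) $ j = (\<Sum>r\<in>UNIV. U $ r $ k * qvec (\<theta> $ r) $ j)"
  by (simp add: S_def sum_3 qvec_add qvec_cst)

lemma det_S: "det (vector [qvec (S 1), qvec (S 2), qvec (S 3)] :: 'a ^ 3 ^ 3) =
    w_c x * det (\<chi> r. qvec (\<theta> $ r))"
proof -
  have "w_c x = det U" using w_c_cov_mat[OF f g] by (simp add: x_def U_def)
  then show ?thesis
    unfolding det_3 vector_3 vec_lambda_beta qvec_S sum_3 by Groebner_Basis.algebra
qed

lemma C_polar: "(\<Sum>r\<in>UNIV. \<Sum>s\<in>UNIV. C_mat x $ r $ s * qvec (\<theta> $ r) $ 1 * qvec (\<theta> $ s) $ 3) =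
    qvec (S 1) $ 1 * qvec (S 3) $ 3 - 2 * qvec (S 2) $ 1 * qvec (S 2) $ 3 + qvec (S 3) $ 1 * qvec (S 1) $ 3"
  unfolding C_mat_cov_mat qvec_S sum_3 by Groebner_Basis.algebra

text \<open>
  The hypothesis says that \<open>\<Sum> \<theta>\<^sub>r(z) u\<^sub>r\<close> is the square of \<open>l\<^bsub>Mz\<^esub>\<close>, where \<open>l\<^sub>z = z\<^sub>1 X\<^sub>1 - z\<^sub>2 X\<^sub>0\<close>. Pairing
  \<open>l\<^sub>z\<^sup>2\<close> with \<open>f\<close> and \<open>l\<^sub>z\<^sup>4\<close> with \<open>g\<close> evaluates these forms at \<open>z\<close>, which gives the first two
  equations. The last two express powers of \<open>det M\<close> by \<open>\<theta>\<close> and the invariants: one compares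
  determinants, the other is the identity \<open>(l\<^sub>z\<^sup>2, l\<^sub>w\<^sup>2)\<^sub>2 = (z\<^sub>1 w\<^sub>2 - z\<^sub>2 w\<^sub>1)\<^sup>2\<close> at the images of the two
  basis vectors.
\<close>

lemma reconstruct:
  assumes S: "S 1 = lin_form M 2 ^ 2" "S 2 = - (lin_form M 1 * lin_form M 2)" "S 3 = lin_form M 1 ^ 2"
  shows "(\<Sum>r\<in>UNIV. cst (A_vec x $ r) * \<theta> $ r) = lin_subst M f"
    "(\<Sum>r\<in>UNIV. \<Sum>s\<in>UNIV. cst (B_mat x $ r $ s) * \<theta> $ r * \<theta> $ s) = lin_subst M g"
    "(\<Sum>r\<in>UNIV. \<Sum>s\<in>UNIV. cst (C_mat x $ r $ s) * \<theta> $ r * \<theta> $ s) = 0"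
    "2 * w_c x * det (\<chi> r. qvec (\<theta> $ r)) = det M ^ 3"
    "(\<Sum>r\<in>UNIV. \<Sum>s\<in>UNIV. C_mat x $ r $ s * qvec (\<theta> $ r) $ 1 * qvec (\<theta> $ s) $ 3) = det M ^ 2"
proof -
  obtain a b c where f': "f = quad a b c" using binary_form_2_quad f by blast
  obtain p q w t v where g': "g = quart p q w t v" using binary_form_4_quart g by blast
  show "(\<Sum>r\<in>UNIV. cst (A_vec x $ r) * \<theta> $ r) = lin_subst M f"
    unfolding A_sum[OF f'] S f' lin_subst_quad by Groebner_Basis.algebra
  show "(\<Sum>r\<in>UNIV. \<Sum>s\<in>UNIV. cst (B_mat x $ r $ s) * \<theta> $ r * \<theta> $ s) = lin_subst M g"
    unfolding B_sum[OF g'] S g' lin_subst_quart by Groebner_Basis.algebra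
  show "(\<Sum>r\<in>UNIV. \<Sum>s\<in>UNIV. cst (C_mat x $ r $ s) * \<theta> $ r * \<theta> $ s) = 0"
    unfolding C_sum S by Groebner_Basis.algebra
  define k l m n where "k = M $ 1 $ 1" and "l = M $ 1 $ 2" and "m = M $ 2 $ 1" and "n = M $ 2 $ 2"
  have M: "M $ 1 $ 1 = k" "M $ 1 $ 2 = l" "M $ 2 $ 1 = m" "M $ 2 $ 2 = n"
    by (simp_all add: k_def l_def m_def n_def)
  have V: "qvec (S 1) = vector [m^2, m * n, n^2]" "qvec (S 3) = vector [k^2, k * l, l^2]"
    "qvec (S 2) = vector [- (k * m), - (k * n + l * m) / 2, - (l * n)]"
    unfolding S lin_form_products[OF M] qvec_quad by simp_all
  have "2 * (w_c x * det (\<chi> r. qvec (\<theta> $ r))) = det M ^ 3"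
    unfolding det_S[symmetric] V
    unfolding det_3 det_2 vector_3 M by (simp add: field_simps eval_nat_numeral)
  then show "2 * w_c x * det (\<chi> r. qvec (\<theta> $ r)) = det M ^ 3" by (simp add: mult.assoc)
  show "(\<Sum>r\<in>UNIV. \<Sum>s\<in>UNIV. C_mat x $ r $ s * qvec (\<theta> $ r) $ 1 * qvec (\<theta> $ s) $ 3) = det M ^ 2"
    unfolding C_polar V det_2 vector_3 M by Groebner_Basis.algebra
qed

end
end

text \<open>
  Both \<open>P\<close> and \<open>R\<close> have discriminant 0, so they are squares of linear forms \<open>N\<close> and \<open>L\<close>; then
  \<open>Q\<^sup>2 = (L N)\<^sup>2\<close>, and the sign of \<open>L\<close> can be chosen such that \<open>Q = - L N\<close>.
\<close>

lemma independent_quads_square: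
  fixes P Q R :: "'a::{field_char_0, alg_closed_field} poly poly"
  assumes bf: "binary_form 2 P" "binary_form 2 Q" "binary_form 2 R" and e: "P * R = Q ^ 2"
    and d: "det (vector [qvec P, qvec Q, qvec R] :: 'a ^ 3 ^ 3) \<noteq> 0"
  shows "\<exists>M. P = lin_form M 2 ^ 2 \<and> Q = - (lin_form M 1 * lin_form M 2) \<and> R = lin_form M 1 ^ 2"
proof -
  obtain p0 p1 p2 where P: "P = quad p0 p1 p2" using binary_form_2_quad bf by blast
  obtain q0 q1 q2 where Q: "Q = quad q0 q1 q2" using binary_form_2_quad bf by blast
  obtain r0 r1 r2 where R: "R = quad r0 r1 r2" using binary_form_2_quad bf by blast
  have d1: "det (vector [vector [p0, p1, p2], vector [q0, q1, q2], vector [r0, r1, r2]] :: 'a ^ 3 ^ 3) \<noteq> 0"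
    using d by (simp add: P Q R qvec_quad)
  then have d2: "det (vector [vector [r0, r1, r2], vector [q0, q1, q2], vector [p0, p1, p2]] :: 'a ^ 3 ^ 3) \<noteq> 0"
    by (simp add: det_3 algebra_simps)
  have "quad p0 p1 p2 * quad r0 r1 r2 = quad q0 q1 q2 * quad q0 q1 q2"
    using e by (simp add: P Q R power2_eq_square)
  note dp = disc_eq_0_of_prod_square[OF this d1]
    and dr = disc_eq_0_of_prod_square[OF trans[OF mult.commute this] d2]
  obtain \<gamma> \<epsilon> where N: "P = (cst \<gamma> * X0 + cst \<epsilon> * X1) ^ 2" using quad_eq_square[OF dp] P by auto
  obtain \<alpha> \<beta> where L: "R = (cst \<alpha> * X0 + cst \<beta> * X1) ^ 2" using quad_eq_square[OF dr] R by auto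
  have "Q ^ 2 = ((cst \<alpha> * X0 + cst \<beta> * X1) * (cst \<gamma> * X0 + cst \<epsilon> * X1)) ^ 2"
    using e by (simp add: N L power_mult_distrib mult.commute)
  then consider "Q = (cst \<alpha> * X0 + cst \<beta> * X1) * (cst \<gamma> * X0 + cst \<epsilon> * X1)"
    | "Q = - ((cst \<alpha> * X0 + cst \<beta> * X1) * (cst \<gamma> * X0 + cst \<epsilon> * X1))"
    by (auto simp: power2_eq_iff)
  then show ?thesis
  proof cases
    case 1
    show ?thesis
      by (rule exI[of _ "vector [vector [- \<alpha>, - \<beta>], vector [\<gamma>, \<epsilon>]]"])
        (simp add: lin_form_def N L 1 cst_hom algebra_simps power2_eq_square)
  next
    case 2
    show ?thesis
      by (rule exI[of _ "vector [vector [\<alpha>, \<beta>], vector [\<gamma>, \<epsilon>]]"]) (simp add: lin_form_def N L 2)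
  qed
qed

lemma binary_form_lin_comb:
  fixes \<theta> :: "'a::field_char_0 poly poly ^ 3"
  assumes "\<And>r. binary_form 2 (\<theta> $ r)"
  shows "binary_form 2 (\<Sum>r\<in>(UNIV :: 3 set). cst (h r) * \<theta> $ r)"
proof -
  have add: "binary_form 2 (F + G)" if "binary_form 2 F" "binary_form 2 G" for F G :: "'a poly poly"
    using that unfolding binary_form_def by (metis add_0 coeff_add)
  show ?thesis unfolding sum_3 by (intro add binary_form_ops(3) assms)
qed

text \<open>
  Every parametrization of the conic by independent quadratic forms comes from the standard one by a
  linear substitution.
\<close>

lemma reparametrize:
  fixes f g :: "'a::{field_char_0, alg_closed_field} poly poly"
  assumes f: "binary_form 2 f" and g: "binary_form 4 g" and \<theta>: "\<And>r. binary_form 2 (\<theta> $ r)"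
    and C: "(\<Sum>r\<in>UNIV. \<Sum>s\<in>UNIV. cst (C_mat (invariants f g) $ r $ s) * \<theta> $ r * \<theta> $ s) = 0"
    and c: "w_c (invariants f g) \<noteq> 0" and d: "det (\<chi> r. qvec (\<theta> $ r)) \<noteq> 0"
  shows "\<exists>M. (\<Sum>r\<in>UNIV. cst (A_vec (invariants f g) $ r) * \<theta> $ r) = lin_subst M f \<and>
    (\<Sum>r\<in>UNIV. \<Sum>s\<in>UNIV. cst (B_mat (invariants f g) $ r $ s) * \<theta> $ r * \<theta> $ s) = lin_subst M g \<and>
    2 * w_c (invariants f g) * det (\<chi> r. qvec (\<theta> $ r)) = det M ^ 3 \<and>
    (\<Sum>r\<in>UNIV. \<Sum>s\<in>UNIV. C_mat (invariants f g) $ r $ s *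
      qvec (\<theta> $ r) $ 1 * qvec (\<theta> $ s) $ 3) = det M ^ 2"
proof -
  define S where "S k = (\<Sum>r\<in>UNIV. cst (cov_mat f g $ r $ k) * \<theta> $ r)" for k
  have e: "S 1 * S 3 = S 2 ^ 2" using C_sum[OF f g, of \<theta>] C by (simp flip: S_def)
  have bf: "binary_form 2 (S k)" for k unfolding S_def by (rule binary_form_lin_comb[OF \<theta>])
  have "det (vector [qvec (S 1), qvec (S 2), qvec (S 3)] :: 'a ^ 3 ^ 3) \<noteq> 0"
    using det_S[OF f g, of \<theta>] c d by (simp flip: S_def)
  then obtain M where "S 1 = lin_form M 2 ^ 2" "S 2 = - (lin_form M 1 * lin_form M 2)"
    "S 3 = lin_form M 1 ^ 2"
    using independent_quads_square[OF bf bf bf e] by blast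
  from reconstruct[OF f g this[unfolded S_def]] show ?thesis by blast
qed

text \<open>
  The standard parametrization \<open>\<theta>\<close> attached to \<open>(f', g')\<close> reconstructs \<open>(f', g')\<close> from the common
  invariants. It also parametrizes the conic of \<open>(f, g)\<close>, so the same formulas give \<open>(f \<circ> M, g \<circ> M)\<close> for
  some \<open>M\<close>. The square and the cube of \<open>det M\<close> depend only on \<open>\<theta>\<close> and the invariants, so they are 1
  as for the identity matrix.
\<close>

lemma same_invariants_equivalent:
  fixes f g f' g' :: "'a::{field_char_0, alg_closed_field} poly poly"
  assumes f: "binary_form 2 f" "binary_form 2 f'" and g: "binary_form 4 g" "binary_form 4 g'"
    and inv: "invariants f g = invariants f' g'" and c: "w_c (invariants f g) \<noteq> 0"
  shows "\<exists>M. det M = 1 \<and> lin_subst M f = f' \<and> lin_subst M g = g'"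
proof -
  define U where "U = cov_mat f' g'"
  define N where "N = matrix_inv U"
  have "det U \<noteq> 0" using c inv w_c_cov_mat[OF f(2) g(2)] by (simp add: U_def)
  then have "invertible U" by (simp add: invertible_det_nz)
  then have "N ** U = mat 1"
    unfolding invertible_def matrix_inv_def N_def by (metis (mono_tags, lifting) someI_ex)
  then have "\<forall>r s. (N ** U) $ r $ s = mat 1 $ r $ s" by simp
  then have NU: "(\<Sum>t\<in>UNIV. N $ r $ t * U $ t $ s) = (if r = s then 1 else 0)" for r s
    by (simp add: matrix_matrix_mult_def mat_def)
  define I :: "'a ^ 2 ^ 2" where "I = mat 1"
  \<comment> \<open>the coordinates of \<open>l\<^sub>z\<^sup>2\<close> as forms in \<open>z\<close>\<close>
  define sq :: "'a poly poly ^ 3"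
    where "sq = vector [lin_form I 2 ^ 2, - (lin_form I 1 * lin_form I 2), lin_form I 1 ^ 2]"
  define \<theta> where "\<theta> = (\<chi> r. \<Sum>k\<in>UNIV. cst (N $ k $ r) * sq $ k)"
  have sq: "binary_form 2 (sq $ k)" for k
    unfolding sq_def using lin_form_products[OF refl refl refl refl, of I] exhaust_3[of k]
    by (auto simp: binary_form_quad)
  have \<theta>: "binary_form 2 (\<theta> $ r)" for r
    unfolding \<theta>_def using binary_form_lin_comb[OF sq] by simp
  have S: "(\<Sum>r\<in>UNIV. cst (U $ r $ k) * \<theta> $ r) = sq $ k" for k
  proof -
    have "(\<Sum>r\<in>UNIV. cst (U $ r $ k) * \<theta> $ r) =
      (\<Sum>j\<in>UNIV. cst (\<Sum>r\<in>UNIV. N $ j $ r * U $ r $ k) * sq $ j)"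
      unfolding \<theta>_def vec_lambda_beta sum_3 cst_hom by Groebner_Basis.algebra
    also have "\<dots> = sq $ k" unfolding NU using exhaust_3[of k] by (auto simp: sum_3 cst_hom)
    finally show ?thesis .
  qed
  note R = reconstruct[OF f(2) g(2), folded U_def inv, of \<theta> I, unfolded S sq_def vector_3,
      OF refl refl refl]
  have I: "lin_subst I F = F" "det I = 1" for F by (simp_all add: I_def lin_subst_id)
  have d: "det (\<chi> r. qvec (\<theta> $ r)) \<noteq> 0" using R(4) by (auto simp: I)
  from reparametrize[OF f(1) g(1) \<theta> R(3) c d] obtain M where
    M: "lin_subst M f = f'" "lin_subst M g = g'" "det M ^ 3 = 1" "det M ^ 2 = 1"
    unfolding R I by auto
  then have "det M = 1" by (simp add: eval_nat_numeral)
  then show ?thesis using M by blast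
qed

section \<open>Base change\<close>

lemma base_change_hom:
  "base_change (F + G) = base_change F + base_change G"
  "base_change (F * G) = base_change F * base_change G"
  "base_change (cst s) = cst (to_ac s)"
proof -
  have a: "map_poly to_ac (p + q) = map_poly to_ac p + map_poly to_ac q" for p q :: "'a poly"
    by (intro poly_eqI) (simp add: coeff_map_poly)
  have m: "map_poly to_ac (p * q) = map_poly to_ac p * map_poly to_ac q" for p q :: "'a poly"
    by (intro poly_eqI) (simp add: coeff_map_poly coeff_mult to_ac_sum)
  have s: "map_poly to_ac (\<Sum>i\<in>I. h i) = (\<Sum>i\<in>I. map_poly to_ac (h i))"
    for h :: "nat \<Rightarrow> 'a poly" and I
    by (induction I rule: infinite_finite_induct) (simp_all add: a)
  show "base_change (F + G) = base_change F + base_change G"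
    unfolding base_change_def by (intro poly_eqI) (simp add: coeff_map_poly a)
  show "base_change (F * G) = base_change F * base_change G"
    unfolding base_change_def by (intro poly_eqI) (simp add: coeff_map_poly coeff_mult s m)
  show "base_change (cst s) = cst (to_ac s)"
    by (simp add: base_change_def cst_def map_poly_pCons)
qed

lemma base_change_sum: "base_change (\<Sum>r\<in>I. h r) = (\<Sum>r\<in>I. base_change (h r))"
proof -
  have "base_change 0 = (0 :: 'a alg_closure poly poly)" by (simp add: base_change_def)
  then show ?thesis
    by (induction I rule: infinite_finite_induct) (simp_all add: base_change_hom)
qed

lemma base_change_quad: "base_change (quad a b c) = quad (to_ac a) (to_ac b) (to_ac c)"
  by (simp add: base_change_def quad_def map_poly_pCons)

lemma base_change_quart: "base_change (quart a b c d e) =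
    quart (to_ac a) (to_ac b) (to_ac c) (to_ac d) (to_ac e)"
  by (simp add: base_change_def quart_def map_poly_pCons)

lemma defined_over_base_change: "defined_over_base (base_change F)"
  by (simp add: defined_over_base_def base_change_def coeff_map_poly)

lemma qvec_base_change: "qvec (base_change F) $ k = to_ac (qvec F $ k)"
proof -
  have "\<forall>k. qvec (base_change F) $ k = to_ac (qvec F $ k)"
    by (simp add: forall_3 qvec_def base_change_def coeff_map_poly)
  then show ?thesis ..
qed

lemma base_change_surj:
  assumes "defined_over_base F"
  shows "\<exists>G. F = base_change G"
proof -
  have z: "of_ac (0 :: 'a alg_closure) = 0" using of_ac_to_ac[of "0 :: 'a"] by simp
  have "F = base_change (map_poly (map_poly of_ac) F)"
    using assms unfolding base_change_def defined_over_base_def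
    by (intro poly_eqI) (simp add: coeff_map_poly z to_ac_of_ac)
  then show ?thesis ..
qed

lemma invariants_base_change:
  assumes "binary_form 2 f" "binary_form 4 g"
  shows "invariants (base_change f) (base_change g) = map_wcoords to_ac (invariants f g)"
proof -
  obtain a b c where f: "f = quad a b c" using binary_form_2_quad assms by blast
  obtain p q r s t where g: "g = quart p q r s t" using binary_form_4_quart assms by blast
  show ?thesis
    unfolding f g base_change_quad base_change_quart
      invariants_eq[OF binary_form_quad binary_form_quart]
      cov_mat_def covs_def cov_H_def quad_quart_simps det_3 vec_lambda_beta vector_3 qvec_quad
    by simp
qed

lemma mats_to_ac:
  shows C_mat_to_ac: "C_mat (map_wcoords to_ac x) $ r $ s = to_ac (C_mat x $ r $ s)"
    and A_vec_to_ac: "A_vec (map_wcoords to_ac x) $ r = to_ac (A_vec x $ r)"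
    and B_mat_to_ac: "B_mat (map_wcoords to_ac x) $ r $ s = to_ac (B_mat x $ r $ s)"
proof -
  have "\<forall>r s. C_mat (map_wcoords to_ac x) $ r $ s = to_ac (C_mat x $ r $ s)"
    by (simp add: forall_3 C_mat_def split: wcoords.split)
  then show "C_mat (map_wcoords to_ac x) $ r $ s = to_ac (C_mat x $ r $ s)" by blast
  have "\<forall>r. A_vec (map_wcoords to_ac x) $ r = to_ac (A_vec x $ r)"
    by (cases x) (simp add: forall_3 A_vec_def)
  then show "A_vec (map_wcoords to_ac x) $ r = to_ac (A_vec x $ r)" by blast
  have "\<forall>r s. B_mat (map_wcoords to_ac x) $ r $ s = to_ac (B_mat x $ r $ s)"
    by (simp add: forall_3 B_mat_def split: wcoords.split)
  then show "B_mat (map_wcoords to_ac x) $ r $ s = to_ac (B_mat x $ r $ s)" by blast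
qed

lemma det_to_ac: "det (\<chi> r s. to_ac (A $ r $ s)) = to_ac (det (A :: 'a::field_char_0 ^ 3 ^ 3))"
  by (simp add: det_3)

lemma C_mat_sym: "C_mat x $ r $ s = C_mat x $ s $ r"
proof -
  have "\<forall>r s. C_mat x $ r $ s = C_mat x $ s $ r"
    by (simp add: forall_3 C_mat_def split: wcoords.split)
  then show ?thesis by blast
qed

lemma theta_ac_coords:
  assumes "binary_form 2 (\<theta> $ r)"
  shows "theta_ac \<theta> z $ r = to_ac (qvec (\<theta> $ r) $ 1) * z $ 1 ^ 2 +
    2 * to_ac (qvec (\<theta> $ r) $ 2) * z $ 1 * z $ 2 + to_ac (qvec (\<theta> $ r) $ 3) * z $ 2 ^ 2"
proof -
  obtain a b c where "\<theta> $ r = quad a b c" using binary_form_2_quad[OF assms] by blast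
  then show ?thesis
    by (simp add: theta_ac_def base_change_quad qvec_quad)
      (simp add: eval_form_def quad_def algebra_simps power2_eq_square)
qed

section \<open>Parametrizations of the conic\<close>

definition bil :: "'a::comm_ring_1 ^ 3 ^ 3 \<Rightarrow> 'a ^ 3 \<Rightarrow> 'a ^ 3 \<Rightarrow> 'a"
  where "bil M p q = (\<Sum>r\<in>UNIV. \<Sum>s\<in>UNIV. M $ r $ s * p $ r * q $ s)"

lemma bil_linear:
  "bil M (p + p') q = bil M p q + bil M p' q" "bil M (s *s p) q = s * bil M p q"
  "bil M p (q + q') = bil M p q + bil M p q'" "bil M p (s *s q) = s * bil M p q"
  by (simp_all add: bil_def sum_3 algebra_simps)

lemma bil_sym:
  assumes "\<And>r s. M $ r $ s = M $ s $ r"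
  shows "bil M p q = bil M q p"
  unfolding bil_def sum_3 by (simp add: assms[of 2 1] assms[of 3 1] assms[of 3 2] algebra_simps)

lemma bil_hom:
  assumes "\<And>s t. h (s + t) = h s + h t" "\<And>s t. h (s * t) = h s * h t"
  shows "bil (\<chi> r s. h (M $ r $ s)) (\<chi> r. h (p $ r)) (\<chi> r. h (q $ r)) = h (bil M p q)"
  by (simp add: bil_def sum_3 assms)

lemma conic_points_bil: "conic_points M = {p. p \<noteq> 0 \<and> bil M p p = 0}"
  by (simp add: conic_points_def bil_def)

lemma det_3_lin_comb_0:
  fixes u v w :: "'a::field ^ 3"
  assumes "det (vector [u, v, w] :: 'a ^ 3 ^ 3) \<noteq> 0" "a *s u + b *s v + c *s w = 0"
  shows "a = 0" "b = 0" "c = 0"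
proof -
  have "a * u $ 1 + b * v $ 1 + c * w $ 1 = 0" "a * u $ 2 + b * v $ 2 + c * w $ 2 = 0"
    "a * u $ 3 + b * v $ 3 + c * w $ 3 = 0"
    using assms(2) by (simp_all add: vec_eq_iff forall_3)
  then have "a * det (vector [u, v, w] :: 'a ^ 3 ^ 3) = 0" "b * det (vector [u, v, w] :: 'a ^ 3 ^ 3) = 0"
    "c * det (vector [u, v, w] :: 'a ^ 3 ^ 3) = 0"
    unfolding det_3 vector_3 by Groebner_Basis.algebra+
  then show "a = 0" "b = 0" "c = 0" using assms(1) by simp_all
qed

lemma det_3_span:
  fixes u v w :: "'a::field ^ 3"
  assumes "det (vector [u, v, w] :: 'a ^ 3 ^ 3) \<noteq> 0"
  shows "\<exists>a b c. p = a *s u + b *s v + c *s w"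
proof -
  define B where "B = (vector [u, v, w] :: 'a ^ 3 ^ 3)"
  have "invertible B" using assms by (simp add: B_def invertible_det_nz)
  then obtain N where "N ** B = mat 1" by (auto simp: invertible_def)
  then have "p = (p v* N) v* B" by (simp add: vector_matrix_mul_assoc)
  moreover have "y v* B = y $ 1 *s u + y $ 2 *s v + y $ 3 *s w" for y
    by (simp add: vec_eq_iff forall_3 vector_matrix_mult_def sum_3 B_def mult.commute)
  ultimately show ?thesis by metis
qed

lemma extend_to_basis:
  fixes q :: "'a::field ^ 3"
  assumes "q \<noteq> 0"
  shows "\<exists>v0 v1. det (vector [q, v0, v1] :: 'a ^ 3 ^ 3) \<noteq> 0"
proof -
  from assms consider "q $ 1 \<noteq> 0" | "q $ 2 \<noteq> 0" | "q $ 3 \<noteq> 0"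
    by (auto simp: vec_eq_iff forall_3)
  then show ?thesis
  proof cases
    case 1
    then show ?thesis
      by (intro exI[of _ "vector [0, 1, 0]"] exI[of _ "vector [0, 0, 1]"]) (simp add: det_3)
  next
    case 2
    then show ?thesis
      by (intro exI[of _ "vector [1, 0, 0]"] exI[of _ "vector [0, 0, 1]"]) (simp add: det_3)
  next
    case 3
    then show ?thesis
      by (intro exI[of _ "vector [1, 0, 0]"] exI[of _ "vector [0, 1, 0]"]) (simp add: det_3)
  qed
qed

lemma proj_eq_2:
  assumes "z \<noteq> 0" "w \<noteq> 0" "w $ 1 * z $ 2 = w $ 2 * z $ 1"
  shows "proj_eq z (w :: 'a::field_char_0 ^ 2)"
proof (cases "z $ 1 = 0")
  case True
  then have "z $ 2 \<noteq> 0" "w $ 1 = 0" using assms by (auto simp: vec_eq_iff forall_2)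
  then show ?thesis using True assms
    by (auto simp: proj_eq_def vec_eq_iff forall_2 intro!: exI[of _ "w $ 2 / z $ 2"])
next
  case False
  then have "w $ 1 \<noteq> 0" using assms by (auto simp: vec_eq_iff forall_2)
  then show ?thesis using False assms
    by (auto simp: proj_eq_def vec_eq_iff forall_2 field_simps intro!: exI[of _ "w $ 1 / z $ 1"])
qed

text \<open>
  For \<open>q\<close> on the conic, this is the second point of intersection with the line joining \<open>q\<close> and \<open>v\<close>:
  the root \<open>t \<noteq> 0\<close> of \<open>M(q + t v, q + t v) = t (2 M(q, v) + t M(v, v))\<close>, with denominators cleared. It
  equals \<open>q\<close> up to a factor if the line is the tangent at \<open>q\<close>.
\<close>

definition second_point :: "'a::comm_ring_1 ^ 3 ^ 3 \<Rightarrow> 'a ^ 3 \<Rightarrow> 'a ^ 3 \<Rightarrow> 'a ^ 3"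
  where "second_point M q v = bil M v v *s q + (- 2 * bil M q v) *s v"

lemma second_point_on_conic:
  assumes sym: "\<And>r s. M $ r $ s = M $ s $ r" and q: "bil M q q = 0"
  shows "bil M (second_point M q v) (second_point M q v) = 0"
  unfolding second_point_def bil_linear q bil_sym[OF sym, of v q] by (simp add: algebra_simps)

text \<open>
  In the coordinates given by \<open>q, v0, v1\<close> the point \<open>T z\<close> is \<open>(Q z, - 2 L z z\<^sub>1, - 2 L z z\<^sub>2)\<close>, where \<open>Q\<close> is
  the quadratic form on the pencil and \<open>L\<close> is the linear form that vanishes on the tangent at \<open>q\<close>.
  Nondegeneracy of \<open>M\<close> means that \<open>Q\<close> and \<open>L\<close> have no common zero except 0, and all properties follow from
  that. The tangent direction \<open>L z = 0\<close> is the parameter of the point \<open>q\<close> itself.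
\<close>

lemma second_point_parametrizes:
  fixes M :: "'a::field_char_0 ^ 3 ^ 3" and q v0 v1 :: "'a ^ 3"
  assumes sym: "\<And>r s. M $ r $ s = M $ s $ r" and M: "det M \<noteq> 0" and q: "bil M q q = 0"
    and v: "det (vector [q, v0, v1] :: 'a ^ 3 ^ 3) \<noteq> 0"
  defines "T \<equiv> \<lambda>z :: 'a ^ 2. second_point M q (z $ 1 *s v0 + z $ 2 *s v1)"
  shows "z \<noteq> 0 \<Longrightarrow> T z \<noteq> 0"
    "z \<noteq> 0 \<Longrightarrow> w \<noteq> 0 \<Longrightarrow> proj_eq (T z) (T w) \<Longrightarrow> proj_eq z w"
    "p \<in> conic_points M \<Longrightarrow> \<exists>z. z \<noteq> 0 \<and> proj_eq (T z) p"
    "det (vector [T z, q, z $ 1 *s v0 + z $ 2 *s v1] :: 'a ^ 3 ^ 3) = 0"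
proof -
  define L0 where "L0 = bil M q v0"
  define L1 where "L1 = bil M q v1"
  define a where "a = bil M v0 v0"
  define b where "b = bil M v0 v1"
  define c where "c = bil M v1 v1"
  define L where "L z = z $ 1 * L0 + z $ 2 * L1" for z :: "'a ^ 2"
  define Q where "Q z = a * z $ 1 ^ 2 + 2 * b * z $ 1 * z $ 2 + c * z $ 2 ^ 2" for z :: "'a ^ 2"
  note bs = bil_sym[OF sym, of v0 q] bil_sym[OF sym, of v1 q] bil_sym[OF sym, of v1 v0]
  have L: "bil M q (z $ 1 *s v0 + z $ 2 *s v1) = L z" for z
    by (simp add: bil_linear L_def L0_def L1_def)
  have Q: "bil M (z $ 1 *s v0 + z $ 2 *s v1) (z $ 1 *s v0 + z $ 2 *s v1) = Q z" for z
    by (simp add: bil_linear Q_def a_def b_def c_def bs power2_eq_square algebra_simps)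
  have T: "T z = Q z *s q + (- 2 * L z * z $ 1) *s v0 + (- 2 * L z * z $ 2) *s v1" for z
    by (simp add: T_def second_point_def L Q vec_eq_iff algebra_simps)
  \<comment> \<open>the value of \<open>Q\<close> at the zero of \<open>L\<close>, which is minus the Gram determinant of \<open>q, v0, v1\<close>\<close>
  define \<Delta> where "\<Delta> = L1 ^ 2 * a - 2 * L0 * L1 * b + L0 ^ 2 * c"
  have \<Delta>: "\<Delta> \<noteq> 0"
  proof -
    define B where "B = (vector [q, v0, v1] :: 'a ^ 3 ^ 3)"
    have "(B ** M ** transpose B) $ r $ s = bil M (B $ r) (B $ s)" for r s
      by (simp add: matrix_matrix_mult_def transpose_def bil_def sum_3 algebra_simps)
    then have "det (B ** M ** transpose B) = - \<Delta>"
      unfolding det_3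
      by (simp add: B_def q L0_def[symmetric] L1_def[symmetric] a_def[symmetric] b_def[symmetric]
          c_def[symmetric] bs \<Delta>_def algebra_simps power2_eq_square)
    moreover have "det (B ** M ** transpose B) = det B * det M * det B"
      by (simp add: det_mul det_transpose)
    ultimately show ?thesis using M v by (auto simp: B_def)
  qed
  have anis: "z = 0" if "L z = 0" "Q z = 0" for z :: "'a ^ 2"
  proof -
    have "\<Delta> * z $ 1 ^ 2 = 0" "\<Delta> * z $ 2 ^ 2 = 0"
      using that unfolding L_def Q_def \<Delta>_def by Groebner_Basis.algebra+
    then show ?thesis using \<Delta> by (simp add: vec_eq_iff forall_2)
  qed
  show "T z \<noteq> 0" if "z \<noteq> 0"
  proof
    assume "T z = 0"
    then have "Q z = 0" "- 2 * L z * z $ 1 = 0" "- 2 * L z * z $ 2 = 0"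
      using det_3_lin_comb_0[OF v] unfolding T by blast+
    then show False using anis that by (auto simp: vec_eq_iff forall_2)
  qed
  show "proj_eq z w" if z: "z \<noteq> 0" and w: "w \<noteq> 0" and e: "proj_eq (T z) (T w)"
  proof (rule proj_eq_2[OF z w])
    obtain s where s: "s \<noteq> 0" "T w = s *s T z" using e by (auto simp: proj_eq_def)
    have "(Q w - s * Q z) *s q + (- 2 * L w * w $ 1 + 2 * s * L z * z $ 1) *s v0 +
      (- 2 * L w * w $ 2 + 2 * s * L z * z $ 2) *s v1 = T w - s *s T z"
      by (simp add: T vec_eq_iff algebra_simps)
    also have "\<dots> = 0" using s by simp
    finally have "- 2 * L w * w $ 1 + 2 * s * L z * z $ 1 = 0"
      "- 2 * L w * w $ 2 + 2 * s * L z * z $ 2 = 0"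
      using det_3_lin_comb_0[OF v] by blast+
    then have "2 * (L w * w $ 1) = 2 * (s * L z * z $ 1)" "2 * (L w * w $ 2) = 2 * (s * L z * z $ 2)"
      by (simp_all add: algebra_simps)
    then have 1: "L w * w $ 1 = s * L z * z $ 1" "L w * w $ 2 = s * L z * z $ 2" by simp_all
    show "w $ 1 * z $ 2 = w $ 2 * z $ 1"
    proof (cases "L w = 0")
      case True
      then have "L z = 0" using 1 s z by (auto simp: vec_eq_iff forall_2)
      have "L0 \<noteq> 0 \<or> L1 \<noteq> 0" using \<Delta> by (auto simp: \<Delta>_def)
      moreover have "L0 * (w $ 1 * z $ 2 - w $ 2 * z $ 1) = 0"
        "L1 * (w $ 1 * z $ 2 - w $ 2 * z $ 1) = 0"
        using \<open>L w = 0\<close> \<open>L z = 0\<close> unfolding L_def by Groebner_Basis.algebra+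
      ultimately show ?thesis by auto
    next
      case False
      have "L w * (w $ 1 * z $ 2 - w $ 2 * z $ 1) = 0" using 1 by Groebner_Basis.algebra
      then show ?thesis using False by simp
    qed
  qed
  show "\<exists>z. z \<noteq> 0 \<and> proj_eq (T z) p" if "p \<in> conic_points M"
  proof -
    have p: "p \<noteq> 0" "bil M p p = 0" using that by (simp_all add: conic_points_bil)
    obtain \<alpha> y1 y2 where y: "p = \<alpha> *s q + y1 *s v0 + y2 *s v1" using det_3_span[OF v] by blast
    define y :: "'a ^ 2" where "y = vector [y1, y2]"
    have py: "p = \<alpha> *s q + (y $ 1 *s v0 + y $ 2 *s v1)" by (simp add: y_def y add.assoc)
    show ?thesis
    proof (cases "y = 0")
      case True
      define z :: "'a ^ 2" where "z = vector [L1, - L0]"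
      have "p = \<alpha> *s q" using py True by simp
      moreover from this p have "\<alpha> \<noteq> 0" by auto
      moreover have "L z = 0" "Q z = \<Delta>" by (simp_all add: z_def L_def Q_def \<Delta>_def algebra_simps)
      moreover have "z \<noteq> 0" using \<open>Q z = \<Delta>\<close> \<Delta> by (auto simp: Q_def)
      ultimately show ?thesis
        using \<Delta> by (intro exI[of _ z]) (simp add: proj_eq_def T exI[of _ "\<alpha> / \<Delta>"])
    next
      case False
      have "bil M p p = \<alpha> * bil M q (y $ 1 *s v0 + y $ 2 *s v1) +
        (\<alpha> * bil M (y $ 1 *s v0 + y $ 2 *s v1) q +
         bil M (y $ 1 *s v0 + y $ 2 *s v1) (y $ 1 *s v0 + y $ 2 *s v1))"
        unfolding py bil_linear(1)[where p = "\<alpha> *s q"] bil_linear(3)[where q = "\<alpha> *s q"]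
          bil_linear(2,4)[where p = q] bil_linear(4)[where q = q] bil_linear(2)[where p = q]
        by (simp add: q bil_linear(2,4))
      then have Qy: "Q y = - 2 * \<alpha> * L y"
        unfolding Q L bil_sym[OF sym, of _ q] p(2) by (simp add: add_eq_0_iff algebra_simps)
      then have "L y \<noteq> 0" using anis[of y] False by auto
      moreover have "T y = (- 2 * L y) *s p"
        unfolding T py Qy by (simp add: vec_eq_iff algebra_simps)
      ultimately show ?thesis using False
        by (intro exI[of _ y]) (simp add: proj_eq_def exI[of _ "- 1 / (2 * L y)"])
    qed
  qed
  show "det (vector [T z, q, z $ 1 *s v0 + z $ 2 *s v1] :: 'a ^ 3 ^ 3) = 0"
    unfolding T_def second_point_def det_3 by (simp add: algebra_simps)
qed

lemma conic_parametrization_exists: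
  fixes x :: "'k::field_char_0 wcoords"
  assumes d: "det (C_mat x) \<noteq> 0" and q: "q \<in> conic_points (C_mat x)"
  shows "\<exists>\<theta>. conic_parametrization x \<theta> \<and> projects_from q \<theta>"
proof -
  define M where "M = C_mat x"
  have sym: "M $ r $ s = M $ s $ r" for r s unfolding M_def by (rule C_mat_sym)
  have q0: "q \<noteq> 0" "bil M q q = 0" using q by (simp_all add: conic_points_bil M_def)
  obtain v0 v1 where v: "det (vector [q, v0, v1] :: 'k ^ 3 ^ 3) \<noteq> 0"
    using extend_to_basis[OF q0(1)] by blast
  define L0 where "L0 = bil M q v0"
  define L1 where "L1 = bil M q v1"
  define a where "a = bil M v0 v0"
  define b where "b = bil M v0 v1"
  define c where "c = bil M v1 v1"
  define \<theta> where "\<theta> = (\<chi> r. quad (a * q $ r - 2 * L0 * v0 $ r)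
    (b * q $ r - L0 * v1 $ r - L1 * v0 $ r) (c * q $ r - 2 * L1 * v1 $ r))"
  have bf: "binary_form 2 (\<theta> $ r)" for r by (simp add: \<theta>_def binary_form_quad)
  \<comment> \<open>the equation of the conic, over the polynomial ring\<close>
  have eq: "(\<Sum>r\<in>UNIV. \<Sum>s\<in>UNIV. cst (C_mat x $ r $ s) * \<theta> $ r * \<theta> $ s) = 0"
  proof -
    define vp :: "'k ^ 3 \<Rightarrow> 'k poly poly ^ 3" where "vp p = (\<chi> r. cst (p $ r))" for p
    define Mp where "Mp = (\<chi> r s. cst (M $ r $ s))"
    have hom: "bil Mp (vp p) (vp p') = cst (bil M p p')" for p p'
      unfolding Mp_def vp_def by (rule bil_hom[OF cst_hom(3,4)])
    have symp: "Mp $ r $ s = Mp $ s $ r" for r s using sym[of r s] by (simp add: Mp_def)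
    have "\<theta> $ r = second_point Mp (vp q) (X0 *s vp v0 + X1 *s vp v1) $ r" for r
    proof -
      have 1: "bil Mp (X0 *s vp v0 + X1 *s vp v1) (X0 *s vp v0 + X1 *s vp v1) =
        cst a * X0 ^ 2 + 2 * cst b * (X0 * X1) + cst c * X1 ^ 2"
        by (simp add: bil_linear hom a_def b_def c_def bil_sym[OF sym, of v1 v0] power2_eq_square
            algebra_simps)
      have 2: "bil Mp (vp q) (X0 *s vp v0 + X1 *s vp v1) = X0 * cst L0 + X1 * cst L1"
        by (simp add: bil_linear hom L0_def L1_def)
      show ?thesis
        unfolding second_point_def 1 2 \<theta>_def vec_lambda_beta quad_eq
        by (simp add: vp_def cst_hom algebra_simps power2_eq_square)
    qed
    then have "\<theta> = second_point Mp (vp q) (X0 *s vp v0 + X1 *s vp v1)" by (simp add: vec_eq_iff)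
    then have "bil Mp \<theta> \<theta> = 0"
      using second_point_on_conic[OF symp] hom[of q q] q0(2) by (simp add: cst_hom)
    then show ?thesis by (simp add: bil_def Mp_def M_def)
  qed
  define M' where "M' = C_mat (map_wcoords to_ac x)"
  have M': "M' = (\<chi> r s. to_ac (M $ r $ s))" by (simp add: M'_def M_def vec_eq_iff C_mat_to_ac)
  have hom: "bil M' (vec_ac p) (vec_ac p') = to_ac (bil M p p')" for p p'
    unfolding M' vec_ac_def by (rule bil_hom) simp_all
  have sym': "M' $ r $ s = M' $ s $ r" for r s using sym[of r s] by (simp add: M')
  have d': "det M' \<noteq> 0" unfolding M' det_to_ac using d by (simp add: M_def)
  have q': "bil M' (vec_ac q) (vec_ac q) = 0" by (simp add: hom q0)
  have "det (vector [vec_ac q, vec_ac v0, vec_ac v1] :: 'k alg_closure ^ 3 ^ 3) =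
    to_ac (det (vector [q, v0, v1] :: 'k ^ 3 ^ 3))"
    by (simp add: det_3 vec_ac_def)
  then have v': "det (vector [vec_ac q, vec_ac v0, vec_ac v1] :: 'k alg_closure ^ 3 ^ 3) \<noteq> 0"
    using v by simp
  have \<theta>: "theta_ac \<theta> z = second_point M' (vec_ac q) (z $ 1 *s vec_ac v0 + z $ 2 *s vec_ac v1)" for z
  proof -
    have 1: "bil M' (z $ 1 *s vec_ac v0 + z $ 2 *s vec_ac v1) (z $ 1 *s vec_ac v0 + z $ 2 *s vec_ac v1) =
      to_ac a * z $ 1 ^ 2 + 2 * to_ac b * z $ 1 * z $ 2 + to_ac c * z $ 2 ^ 2"
      by (simp add: bil_linear hom a_def b_def c_def bil_sym[OF sym, of v1 v0] power2_eq_square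
          algebra_simps)
    have 2: "bil M' (vec_ac q) (z $ 1 *s vec_ac v0 + z $ 2 *s vec_ac v1) =
      z $ 1 * to_ac L0 + z $ 2 * to_ac L1"
      by (simp add: bil_linear hom L0_def L1_def)
    show ?thesis
      unfolding second_point_def 1 2 vec_eq_iff theta_ac_coords[OF bf]
      by (simp add: \<theta>_def qvec_quad vec_ac_def algebra_simps power2_eq_square)
  qed
  note par = second_point_parametrizes[OF sym' d' q' v', folded \<theta>]
  have "conic_parametrization x \<theta>"
    unfolding conic_parametrization_def M'_def[symmetric] using bf eq par(1-3) by blast
  moreover have "projects_from q \<theta>"
    unfolding projects_from_def using v par(4) by blast
  ultimately show ?thesis by blast
qed

text \<open>
  The vectors \<open>v\<close> with \<open>v\<^sub>2\<^sup>2 = v\<^sub>1 v\<^sub>3\<close> are the coefficients of the isotropic quadratic forms. The point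
  is the coordinate vector of such a form in the basis of covariants.
\<close>

lemma conic_point_of_square:
  fixes f g :: "'a::field_char_0 poly poly" and v :: "'a ^ 3"
  assumes f: "binary_form 2 f" and g: "binary_form 4 g" and c: "w_c (invariants f g) \<noteq> 0"
    and v: "v \<noteq> 0" "v $ 2 ^ 2 = v $ 1 * v $ 3"
  shows "\<exists>p \<in> conic_points (C_mat (invariants f g)). p v* cov_mat f g = v"
proof -
  define U where "U = cov_mat f g"
  have "invertible U" using c w_c_cov_mat[OF f g] by (simp add: U_def invertible_det_nz)
  then obtain N where N: "N ** U = mat 1" by (auto simp: invertible_def)
  define p where "p = v v* N"
  have pU: "p v* U = v" unfolding p_def vector_matrix_mul_assoc N by simp
  then have V: "(\<Sum>r\<in>UNIV. p $ r * U $ r $ k) = v $ k" for k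
    by (auto simp: vector_matrix_mult_def mult.commute)
  have "bil (C_mat (invariants f g)) p p = 2 * (v $ 1 * v $ 3 - v $ 2 ^ 2)"
    unfolding bil_def C_mat_cov_mat[OF f g] U_def[symmetric] V[symmetric] sum_3
    by Groebner_Basis.algebra
  then have "bil (C_mat (invariants f g)) p p = 0" using v by simp
  moreover have "p \<noteq> 0" using pU v(1) by auto
  ultimately show ?thesis using pU by (auto simp: conic_points_bil U_def)
qed

text \<open>
  A linear relation between the \<open>\<theta>\<^sub>r\<close> would put all points of the conic on a line, since \<open>\<theta>\<close> reaches
  all of them. But the conic has three points that are not collinear: those given by the squares
  \<open>X\<^sub>0\<^sup>2\<close>, \<open>X\<^sub>1\<^sup>2\<close> and \<open>(X\<^sub>0 + X\<^sub>1)\<^sup>2\<close>.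
\<close>

lemma parametrization_independent:
  fixes x :: "'k::field_char_0 wcoords"
  assumes f: "binary_form 2 f" and g: "binary_form 4 g"
    and inv: "invariants f g = map_wcoords to_ac x" and c: "w_c x \<noteq> 0"
    and \<theta>: "conic_parametrization x \<theta>"
  shows "det (\<chi> r. qvec (\<theta> $ r)) \<noteq> 0"
proof
  assume d: "det (\<chi> r. qvec (\<theta> $ r)) = 0"
  define \<Theta> :: "'k alg_closure ^ 3 ^ 3" where "\<Theta> = (\<chi> r s. to_ac (qvec (\<theta> $ r) $ s))"
  have "det \<Theta> = to_ac (det (\<chi> r. qvec (\<theta> $ r)))"
    unfolding \<Theta>_def by (subst det_to_ac[symmetric]) simp
  then have "det (transpose \<Theta>) = 0" using d by (simp add: det_transpose)
  then have "\<not> invertible (transpose \<Theta>)" by (simp add: invertible_det_nz)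
  then obtain n where n: "n \<noteq> 0" "transpose \<Theta> *v n = 0"
    using matrix_left_invertible_ker[of "transpose \<Theta>"]
      invertible_left_inverse[of "transpose \<Theta>"] by blast
  have bf: "binary_form 2 (\<theta> $ r)" for r using \<theta> by (simp add: conic_parametrization_def)
  have nk: "(\<Sum>r\<in>UNIV. n $ r * to_ac (qvec (\<theta> $ r) $ k)) = 0" for k
    using n(2) by (simp add: vec_eq_iff matrix_vector_mult_def transpose_def \<Theta>_def mult.commute)
  have nT: "(\<Sum>r\<in>UNIV. n $ r * theta_ac \<theta> z $ r) = 0" for z
    using nk[of 1] nk[of 2] nk[of 3] unfolding theta_ac_coords[OF bf] sum_3 by Groebner_Basis.algebra
  define U where "U = cov_mat f g"
  have cK: "w_c (invariants f g) \<noteq> 0" using c by (simp add: inv wcoords.map_sel)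
  then have "invertible U" using w_c_cov_mat[OF f g] by (simp add: U_def invertible_det_nz)
  then obtain N where N: "N ** U = mat 1" "U ** N = mat 1" by (auto simp: invertible_def)
  define m where "m = N *v n"
  have mv: "(\<Sum>k\<in>UNIV. v $ k * m $ k) = 0" if v: "v \<noteq> 0" "v $ 2 ^ 2 = v $ 1 * v $ 3" for v
  proof -
    obtain p where p: "p \<in> conic_points (C_mat (invariants f g))" "p v* U = v"
      using conic_point_of_square[OF f g cK v] by (auto simp: U_def)
    then obtain z where "proj_eq (theta_ac \<theta> z) p"
      using \<theta> unfolding conic_parametrization_def inv by blast
    then obtain s where s: "p = s *s theta_ac \<theta> z" by (auto simp: proj_eq_def)
    have "p = v v* N" using p(2) N(2) by (metis vector_matrix_mul_assoc vector_matrix_mul_rid)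
    then have "(\<Sum>k\<in>UNIV. v $ k * m $ k) = (\<Sum>r\<in>UNIV. n $ r * p $ r)"
      by (simp add: m_def vector_matrix_mult_def matrix_vector_mult_def sum_3 algebra_simps)
    also have "\<dots> = s * (\<Sum>r\<in>UNIV. n $ r * theta_ac \<theta> z $ r)" by (simp add: s sum_3 algebra_simps)
    finally show ?thesis by (simp add: nT)
  qed
  have "m $ 1 = 0" "m $ 3 = 0" "m $ 1 + m $ 2 + m $ 3 = 0"
    using mv[of "vector [1, 0, 0]"] mv[of "vector [0, 0, 1]"] mv[of "vector [1, 1, 1]"]
    by (simp_all add: sum_3 vec_eq_iff forall_3)
  then have "m = 0" by (simp add: vec_eq_iff forall_3)
  moreover have "n = U *v m" by (simp add: m_def matrix_vector_mul_assoc N)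
  ultimately show False using n(1) by simp
qed

section \<open>Models of moduli points\<close>

lemma wscale_1: "wscale 1 y = y"
  by (cases y) (simp add: wscale_def)

lemma wscale_invariants:
  assumes "binary_form 2 f" "binary_form 4 g"
  shows "invariants (cst s * f) (cst s * g) = wscale s (invariants f g)"
  unfolding invariants_scale[OF assms] wscale_def
  by (cases "invariants f g") (simp add: eval_nat_numeral)

text \<open>
  Scaling \<open>(F\<^sub>0, F\<^sub>1)\<close> by \<open>s\<close> does not change the map and acts on the invariants by the weights, so any
  choice of weighted coordinates is attained exactly.
\<close>

lemma moduli_point_normalize:
  assumes "P \<in> M3" "P = wp_point y"
  shows "\<exists>F0 F1. cubic_map F0 F1 \<and> invariants (map_f F0 F1) (map_g F0 F1) = y"
proof -
  obtain F0 F1 where F: "cubic_map F0 F1" "P = moduli_point F0 F1" using assms(1) by (auto simp: M3_def)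
  have "y \<in> P"
    unfolding assms(2) wp_point_def using wscale_1[of y]
    by (metis (mono_tags, lifting) mem_Collect_eq one_neq_zero)
  then obtain s where s: "s \<noteq> 0" "y = wscale s (invariants (map_f F0 F1) (map_g F0 F1))"
    using F(2) by (auto simp: moduli_point_def wp_point_def)
  show ?thesis
    using cubic_map_scale[OF F(1) s(1)] s(2) wscale_invariants[OF binary_form_map[OF F(1)], of s]
    by (intro exI[of _ "cst s * F0"] exI[of _ "cst s * F1"]) (simp add: map_scale)
qed

lemma w_c_nonzero:
  assumes "P \<in> M3_rational" "P \<notin> c_locus" "P = wp_point (map_wcoords to_ac x)"
  shows "w_c x \<noteq> 0"
proof
  assume "w_c x = 0"
  moreover have "map_wcoords to_ac x \<in> P"
    unfolding assms(3) wp_point_def using wscale_1[of "map_wcoords to_ac x"]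
    by (metis (mono_tags, lifting) mem_Collect_eq one_neq_zero)
  moreover have "P \<in> weighted_proj" using assms(1) by (simp add: M3_rational_def M3_def)
  ultimately show False using assms(2) by (force simp: c_locus_def wcoords.map_sel)
qed

text \<open>
  The forms are \<open>f \<circ> M / det M\<close> and \<open>g \<circ> M / (det M)\<^sup>2\<close> for the substitution \<open>M\<close> that relates \<open>\<theta>\<close> to the
  standard parametrization. These have the same invariants as \<open>f\<close> and \<open>g\<close>.
\<close>

lemma model_from_parametrization:
  fixes x :: "'k::field_char_0 wcoords"
  assumes P: "P \<in> M3" "P = wp_point (map_wcoords to_ac x)" and c: "w_c x \<noteq> 0"
    and \<theta>: "conic_parametrization x \<theta>"
  shows "\<exists>\<beta> f g. \<beta> \<noteq> 0 \<and>
               f = cst (1 / (\<beta> * w_c x)) * (\<Sum>r\<in>UNIV. cst (A_vec x $ r) * \<theta> $ r) \<and>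
               g = cst (1 / (\<beta> ^ 2 * w_c x ^ 2)) *
                     (\<Sum>r\<in>UNIV. \<Sum>s\<in>UNIV. cst (B_mat x $ r $ s) * \<theta> $ r * \<theta> $ s) \<and>
               is_model P (base_change f) (base_change g)"
proof -
  obtain F0 F1 where F: "cubic_map F0 F1" "invariants (map_f F0 F1) (map_g F0 F1) = map_wcoords to_ac x"
    using moduli_point_normalize[OF P] by blast
  define f g where "f = map_f F0 F1" and "g = map_g F0 F1"
  have fg: "binary_form 2 f" "binary_form 4 g" using binary_form_map[OF F(1)] by (simp_all add: f_def g_def)
  have inv: "invariants f g = map_wcoords to_ac x" using F(2) by (simp add: f_def g_def)
  define \<theta>' where "\<theta>' = (\<chi> r. base_change (\<theta> $ r))"
  have bf: "binary_form 2 (\<theta> $ r)" for r using \<theta> by (simp add: conic_parametrization_def)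
  have bf': "binary_form 2 (\<theta>' $ r)" for r
    using binary_form_2_quad[OF bf, of r] by (auto simp: \<theta>'_def base_change_quad binary_form_quad)
  note hom = base_change_sum base_change_hom
  have eq: "(\<Sum>r\<in>UNIV. \<Sum>s\<in>UNIV. cst (C_mat (invariants f g) $ r $ s) * \<theta>' $ r * \<theta>' $ s) = 0"
  proof -
    have "(\<Sum>r\<in>UNIV. \<Sum>s\<in>UNIV. cst (C_mat (invariants f g) $ r $ s) * \<theta>' $ r * \<theta>' $ s) =
      base_change (\<Sum>r\<in>UNIV. \<Sum>s\<in>UNIV. cst (C_mat x $ r $ s) * \<theta> $ r * \<theta> $ s)"
      by (simp add: hom \<theta>'_def inv C_mat_to_ac)
    also have "\<dots> = base_change 0" using \<theta> by (simp add: conic_parametrization_def)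
    finally show ?thesis by (simp add: base_change_def)
  qed
  define e where "e = det (\<chi> r. qvec (\<theta> $ r))"
  have e: "e \<noteq> 0" unfolding e_def by (rule parametrization_independent[OF fg inv c \<theta>])
  have e': "det (\<chi> r. qvec (\<theta>' $ r)) = to_ac e"
    unfolding e_def by (subst det_to_ac[symmetric]) (simp add: det_3 \<theta>'_def qvec_base_change)
  have cK: "w_c (invariants f g) \<noteq> 0" using c by (simp add: inv wcoords.map_sel)
  obtain M where M: "(\<Sum>r\<in>UNIV. cst (A_vec (invariants f g) $ r) * \<theta>' $ r) = lin_subst M f"
    "(\<Sum>r\<in>UNIV. \<Sum>s\<in>UNIV. cst (B_mat (invariants f g) $ r $ s) * \<theta>' $ r * \<theta>' $ s) = lin_subst M g"
    "2 * w_c (invariants f g) * to_ac e = det M ^ 3"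
    "(\<Sum>r\<in>UNIV. \<Sum>s\<in>UNIV. C_mat (invariants f g) $ r $ s *
      qvec (\<theta>' $ r) $ 1 * qvec (\<theta>' $ s) $ 3) = det M ^ 2"
    using reparametrize[OF fg bf' eq cK] e e' by auto
  \<comment> \<open>\<open>det M\<close> lies in \<open>k\<close>, as its square and its cube do\<close>
  define e2 where
    "e2 = (\<Sum>r\<in>UNIV. \<Sum>s\<in>UNIV. C_mat x $ r $ s * qvec (\<theta> $ r) $ 1 * qvec (\<theta> $ s) $ 3)"
  define \<delta> where "\<delta> = 2 * w_c x * e / e2"
  have 3: "det M ^ 3 = to_ac (2 * w_c x * e)" using M(3) by (simp add: inv wcoords.map_sel)
  have 2: "det M ^ 2 = to_ac e2"
    using M(4) by (simp add: e2_def inv C_mat_to_ac \<theta>'_def qvec_base_change to_ac_sum)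
  have M0: "det M \<noteq> 0" using 3 c e by auto
  have "det M = det M ^ 3 / det M ^ 2" using M0 by (simp add: eval_nat_numeral)
  also have "\<dots> = to_ac \<delta>" unfolding 2 3 \<delta>_def by simp
  finally have \<delta>: "det M = to_ac \<delta>" .
  have \<delta>0: "\<delta> \<noteq> 0" using M0 \<delta> by auto
  define \<beta> where "\<beta> = \<delta> / w_c x"
  have \<beta>: "\<beta> \<noteq> 0" "\<beta> * w_c x = \<delta>" "\<beta> ^ 2 * w_c x ^ 2 = \<delta> ^ 2"
    using \<delta>0 c by (simp_all add: \<beta>_def power_divide)
  define f' where "f' = cst (1 / (\<beta> * w_c x)) * (\<Sum>r\<in>UNIV. cst (A_vec x $ r) * \<theta> $ r)"
  define g' where "g' = cst (1 / (\<beta> ^ 2 * w_c x ^ 2)) *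
                     (\<Sum>r\<in>UNIV. \<Sum>s\<in>UNIV. cst (B_mat x $ r $ s) * \<theta> $ r * \<theta> $ s)"
  have f': "base_change f' = cst (1 / det M) * lin_subst M f"
    unfolding f'_def M(1)[symmetric] \<beta> \<delta> by (simp add: hom inv A_vec_to_ac \<theta>'_def)
  have g': "base_change g' = cst (1 / det M / det M) * lin_subst M g"
    unfolding g'_def M(2)[symmetric] \<beta> \<delta> by (simp add: hom inv B_mat_to_ac \<theta>'_def power2_eq_square)
  have "1 / det M \<noteq> 0" using M0 by simp
  from model_lin_subst[OF F(1) M0 this] obtain G0 G1 where
    G: "cubic_map G0 G1" "base_change f' = map_f G0 G1" "base_change g' = map_g G0 G1"
    unfolding f' g' f_def g_def by metis
  have "invariants (base_change f') (base_change g') = map_wcoords to_ac x"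
    unfolding f' g' invariants_scale[OF binary_form_ops(1)[OF fg(1)] binary_form_ops(2)[OF fg(2)]]
      invariants_lin_subst[OF fg] inv
    using M0 by (cases x) (simp add: field_simps eval_nat_numeral)
  then have "is_model P (base_change f') (base_change g')"
    unfolding is_model_def P(2) using G by auto
  then show ?thesis using \<beta>(1) f'_def g'_def by blast
qed

text \<open>
  The pairs \<open>(f, g)\<close> and \<open>(\<zeta> f, \<zeta> g)\<close> have the same invariants, so some \<open>M\<close> of determinant 1 takes one to
  the other. It fixes the cubic map, because \<open>(\<zeta> F\<^sub>0, \<zeta> F\<^sub>1)\<close> is the same map as \<open>(F\<^sub>0, F\<^sub>1)\<close>. It is not
  scalar: a scalar matrix of determinant 1 is \<open>1\<close> or \<open>-1\<close>, which acts trivially on quadratic forms,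
  whereas \<open>f \<noteq> \<zeta> f\<close>.
\<close>

lemma Aut_map_of_stabilizer:
  assumes F: "cubic_map F0 F1" and c: "w_c (invariants (map_f F0 F1) (map_g F0 F1)) \<noteq> 0"
    and \<zeta>: "\<zeta> \<noteq> 1" "wscale \<zeta> (invariants (map_f F0 F1) (map_g F0 F1)) =
      invariants (map_f F0 F1) (map_g F0 F1)"
  shows "Aut_map F0 F1 \<noteq> {pgl_class (mat 1 :: 'a::{field_char_0, alg_closed_field} ^ 2 ^ 2)}"
proof -
  define f g where "f = map_f F0 F1" and "g = map_g F0 F1"
  have fg: "binary_form 2 f" "binary_form 4 g" using binary_form_map[OF F] by (simp_all add: f_def g_def)
  have F3: "binary_form 3 F0" "binary_form 3 F1" using F by (simp_all add: cubic_map_def)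
  have "invariants f g = invariants (cst \<zeta> * f) (cst \<zeta> * g)"
    using \<zeta>(2) unfolding wscale_invariants[OF fg] by (simp add: f_def g_def)
  from same_invariants_equivalent[OF fg(1) binary_form_ops(3)[OF fg(1)]
      fg(2) binary_form_ops(4)[OF fg(2)] this]
  obtain M where M: "det M = 1" "lin_subst M f = cst \<zeta> * f" "lin_subst M g = cst \<zeta> * g"
    using c by (auto simp: f_def g_def)
  obtain G0 G1 where G: "conj_map M (F0, F1) = (G0, G1)" by fastforce
  have M0: "det M \<noteq> 0" using M(1) by simp
  note C = conj_map_forms[OF M0 F3 G, folded f_def g_def]
  have Z3: "binary_form 3 (cst \<zeta> * F0)" "binary_form 3 (cst \<zeta> * F1)"
    using F3 by (auto dest!: binary_form_3_cub simp: cst_mult_cub binary_form_cub)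
  have "map_f G0 G1 = map_f (cst \<zeta> * F0) (cst \<zeta> * F1)"
    "map_g G0 G1 = map_g (cst \<zeta> * F0) (cst \<zeta> * F1)"
    by (simp_all add: C map_scale M cst_hom flip: f_def g_def)
  from map_f_g_inject[OF C(1,2) Z3 this] have "same_map (conj_map M (F0, F1)) (F0, F1)"
    by (simp add: G same_map_def mult_ac)
  moreover have "invertible M" using M0 by (simp add: invertible_det_nz)
  ultimately have "pgl_class M \<in> Aut_map F0 F1" by (auto simp: Aut_map_def)
  moreover have "pgl_class M \<noteq> pgl_class (mat 1)"
  proof
    assume e: "pgl_class M = pgl_class (mat 1)"
    have "M \<in> pgl_class M" by (auto simp: pgl_class_def vec_eq_iff intro!: exI[of _ 1])
    then obtain t where t: "M = (\<chi> r s. t * mat 1 $ r $ s)" unfolding e by (auto simp: pgl_class_def)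
    have m: "M $ 1 $ 1 = t" "M $ 1 $ 2 = 0" "M $ 2 $ 1 = 0" "M $ 2 $ 2 = t" by (simp_all add: t mat_def)
    have "t ^ 2 = 1" using M(1) by (simp add: det_2 m power2_eq_square)
    obtain u v w where f: "f = quad u v w" using binary_form_2_quad fg by blast
    have "lin_subst M f = f"
      unfolding f lin_subst_quad_coords[OF m] quad_eq_iff using \<open>t ^ 2 = 1\<close>
      by (simp add: power2_eq_square)
    then have "quad u v w = quad (\<zeta> * u) (\<zeta> * v) (\<zeta> * w)" using M(2) by (simp add: f cst_mult_quad)
    then have "u = 0" "v = 0" "w = 0" using \<zeta>(1) by (auto simp: quad_eq_iff)
    then have "det (cov_mat f g) = 0" by (simp add: det_3 cov_mat_def covs_def f qvec_quad)
    then show False using c w_c_cov_mat[OF fg] by (simp add: f_def g_def)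
  qed
  ultimately show ?thesis by blast
qed

text \<open>
  The weighted action of \<open>s\<close> changes \<open>C\<close> to \<open>D C D\<close> with \<open>D\<close> the diagonal matrix of \<open>s, s\<^sup>2, s\<^sup>3\<close>.
\<close>

lemma conic_points_wscale:
  assumes "conic_points (C_mat (wscale s x)) \<noteq> {}" "s \<noteq> 0"
  shows "conic_points (C_mat x) \<noteq> {}"
proof -
  obtain p where p: "p \<noteq> 0" "bil (C_mat (wscale s x)) p p = 0"
    using assms(1) by (auto simp: conic_points_bil)
  define p' :: "'a ^ 3" where "p' = vector [s * p $ 1, s ^ 2 * p $ 2, s ^ 3 * p $ 3]"
  have "bil (C_mat x) p' p' = bil (C_mat (wscale s x)) p p"
    by (cases x) (simp add: bil_def sum_3 C_mat_def wscale_def p'_def algebra_simps eval_nat_numeral)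
  moreover have "p' \<noteq> 0" using p(1) assms(2) by (auto simp: p'_def vec_eq_iff forall_3)
  ultimately show ?thesis using p by (auto simp: conic_points_bil)
qed

lemma primitive_cube_root:
  "\<exists>w :: 'a::{field_char_0, alg_closed_field}. w \<noteq> 1 \<and> w ^ 3 = 1"
proof -
  obtain w :: 'a where "poly [:1, 1, 1:] w = 0"
    using alg_closed_imp_poly_has_root[of "[:1, 1, 1:] :: 'a poly"] by auto
  then have w: "1 + w + w ^ 2 = 0" by (simp add: algebra_simps power2_eq_square)
  then have "w ^ 3 = 1" by Groebner_Basis.algebra
  moreover have "w \<noteq> 1" using w by auto
  ultimately show ?thesis by blast
qed

text \<open>
  Outside the automorphism locus only 1 fixes \<open>x\<close>. As \<open>-1\<close> does not fix \<open>x\<close>, one of the coordinates of weight 3 is nonzero, so \<open>s\<^sup>3\<close> is in the base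
  field. As a primitive cube root of unity does not fix \<open>x\<close> either, one of the coordinates of weights 2
  and 4 is nonzero, so \<open>s\<^sup>2\<close> or \<open>s\<^sup>4\<close> is in the base field. In either case a
  quotient of the two powers is \<open>s\<close>.
\<close>

lemma scaling_factor_rational:
  fixes x y :: "'k::field_char_0 wcoords"
  assumes P: "P \<in> M3" "P = wp_point (map_wcoords to_ac x)" "P \<notin> M3_Aut" and c: "w_c x \<noteq> 0"
    and s: "s \<noteq> 0" "map_wcoords to_ac y = wscale s (map_wcoords to_ac x)"
  shows "\<exists>s'. s' \<noteq> 0 \<and> y = wscale s' x"
proof -
  obtain F0 F1 where F: "cubic_map F0 F1" "invariants (map_f F0 F1) (map_g F0 F1) = map_wcoords to_ac x"
    using moduli_point_normalize[OF P(1,2)] by blast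
  have stab: "\<zeta> = 1" if "wscale \<zeta> (map_wcoords to_ac x) = map_wcoords to_ac x" for \<zeta>
  proof (rule ccontr)
    assume "\<zeta> \<noteq> 1"
    then have "Aut_map F0 F1 \<noteq> {pgl_class (mat 1)}"
      using Aut_map_of_stabilizer[OF F(1)] that c by (simp add: F(2) wcoords.map_sel)
    moreover have "P = moduli_point F0 F1" by (simp add: P(2) moduli_point_def F(2))
    ultimately show False using P(1,3) F(1) by (auto simp: M3_Aut_def)
  qed
  obtain d i j a b c where x: "x = WCoords d i j a b c" by (cases x)
  obtain d' i' j' a' b' c' where y: "y = WCoords d' i' j' a' b' c'" by (cases y)
  have e: "to_ac d' = s ^ 2 * to_ac d" "to_ac i' = s ^ 2 * to_ac i" "to_ac j' = s ^ 3 * to_ac j"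
    "to_ac a' = s ^ 3 * to_ac a" "to_ac b' = s ^ 4 * to_ac b" "to_ac c' = s ^ 6 * to_ac c"
    using s(2) by (simp_all add: x y wscale_def)
  have quot: "t \<in> range to_ac" if "to_ac u = t * to_ac v" "v \<noteq> 0" for t and u v :: 'k
  proof -
    have "t = to_ac (u / v)" using that by simp
    then show ?thesis by blast
  qed
  have "j \<noteq> 0 \<or> a \<noteq> 0"
  proof (rule ccontr)
    assume "\<not> (j \<noteq> 0 \<or> a \<noteq> 0)"
    then have "wscale (- 1) (map_wcoords to_ac x) = map_wcoords to_ac x" by (simp add: x wscale_def)
    then have "(- 1 :: 'k alg_closure) = 1" by (rule stab)
    then show False by simp
  qed
  then have s3: "s ^ 3 \<in> range to_ac" using quot[OF e(3)] quot[OF e(4)] by blast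
  have "d \<noteq> 0 \<or> i \<noteq> 0 \<or> b \<noteq> 0"
  proof (rule ccontr)
    assume z: "\<not> (d \<noteq> 0 \<or> i \<noteq> 0 \<or> b \<noteq> 0)"
    obtain w :: "'k alg_closure" where w: "w \<noteq> 1" "w ^ 3 = 1" using primitive_cube_root by blast
    then have "w ^ 6 = 1" using power_mult[of w 3 2] by simp
    then have "wscale w (map_wcoords to_ac x) = map_wcoords to_ac x"
      using z w by (simp add: x wscale_def)
    then show False using stab w by blast
  qed
  then consider "s ^ 2 \<in> range to_ac" | "s ^ 4 \<in> range to_ac"
    using quot[OF e(1)] quot[OF e(2)] quot[OF e(5)] by blast
  then have "s \<in> range to_ac"
  proof cases
    case 1
    have "s = s ^ 3 / s ^ 2" using s(1) by (simp add: eval_nat_numeral)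
    then show ?thesis using 1 s3 by (metis (no_types, lifting) imageE rangeI to_ac_divide)
  next
    case 2
    have "s = s ^ 4 / s ^ 3" using s(1) by (simp add: eval_nat_numeral)
    then show ?thesis using 2 s3 by (metis (no_types, lifting) imageE rangeI to_ac_divide)
  qed
  then obtain s' where s': "s = to_ac s'" by blast
  have "y = wscale s' x"
    using e by (simp add: x y wscale_def s' flip: to_ac_power to_ac_mult)
  then show ?thesis using s s' by auto
qed

text \<open>
  The square \<open>X\<^sub>0\<^sup>2\<close> gives a rational point on the conic of the invariants of the model, and this conic
  is isomorphic over the base field to that of \<open>x\<close>.
\<close>

lemma conic_point_from_model:
  fixes x :: "'k::field_char_0 wcoords"
  assumes P: "P \<in> M3" "P = wp_point (map_wcoords to_ac x)" "P \<notin> M3_Aut" and c: "w_c x \<noteq> 0"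
    and m: "is_model P f g" "defined_over_base f" "defined_over_base g"
  shows "conic_points (C_mat x) \<noteq> {}"
proof -
  obtain f' g' where fg: "f = base_change f'" "g = base_change g'"
    using base_change_surj m(2,3) by blast
  obtain F0 F1 where F: "cubic_map F0 F1" "f = map_f F0 F1" "g = map_g F0 F1"
    and inv: "wp_point (invariants f g) = P"
    using m(1) by (auto simp: is_model_def)
  have "binary_form 2 f" "binary_form 4 g" using binary_form_map[OF F(1)] F by simp_all
  then have bf: "binary_form 2 f'" "binary_form 4 g'"
    by (simp_all add: fg binary_form_def base_change_def coeff_map_poly)
  have "invariants f g \<in> P"
    unfolding inv[symmetric] wp_point_def using wscale_1[of "invariants f g"]
    by (metis (mono_tags, lifting) mem_Collect_eq one_neq_zero)
  then obtain s where s: "s \<noteq> 0" "map_wcoords to_ac (invariants f' g') = wscale s (map_wcoords to_ac x)"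
    unfolding P(2) fg invariants_base_change[OF bf] by (auto simp: wp_point_def)
  obtain s' where s': "s' \<noteq> 0" "invariants f' g' = wscale s' x"
    using scaling_factor_rational[OF P c s] by blast
  have "w_c (invariants f' g') \<noteq> 0" using c s' by (simp add: wscale_def)
  then have "conic_points (C_mat (invariants f' g')) \<noteq> {}"
    using conic_point_of_square[OF bf, of "vector [1, 0, 0]"] by (auto simp: vec_eq_iff forall_3)
  then show ?thesis unfolding s'(2) by (rule conic_points_wscale[OF _ s'(1)])
qed

theorem theorem4p3:
  fixes P :: "'k::field_char_0 alg_closure wcoords set"
    and x :: "'k wcoords"
  assumes "P \<in> M3_rational"
    and "P \<notin> c_locus"
    and "P = wp_point (map_wcoords to_ac x)"
  shows "(conic_points (C_mat x) \<noteq> {} \<longrightarrow>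
           (\<exists>f g. is_model P f g \<and> defined_over_base f \<and> defined_over_base g)) \<and>
         (\<forall>q \<in> conic_points (C_mat x).
           (\<exists>\<theta>. conic_parametrization x \<theta> \<and> projects_from q \<theta>) \<and>
           (\<forall>\<theta>. conic_parametrization x \<theta> \<and> projects_from q \<theta> \<longrightarrow>
             (\<exists>\<beta> f g. \<beta> \<noteq> 0 \<and>
               f = cst (1 / (\<beta> * w_c x)) * (\<Sum>r\<in>UNIV. cst (A_vec x $ r) * \<theta> $ r) \<and>
               g = cst (1 / (\<beta> ^ 2 * w_c x ^ 2)) *
                     (\<Sum>r\<in>UNIV. \<Sum>s\<in>UNIV. cst (B_mat x $ r $ s) * \<theta> $ r * \<theta> $ s) \<and>
               is_model P (base_change f) (base_change g)))) \<and>
         (P \<notin> M3_Aut \<longrightarrow>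
           (conic_points (C_mat x) \<noteq> {} \<longleftrightarrow>
             (\<exists>f g. is_model P f g \<and> defined_over_base f \<and> defined_over_base g)))"
proof -
  have c: "w_c x \<noteq> 0" using assms by (rule w_c_nonzero)
  have M3: "P \<in> M3" using assms(1) by (simp add: M3_rational_def)
  obtain F0 F1 where F: "cubic_map F0 F1" "invariants (map_f F0 F1) (map_g F0 F1) = map_wcoords to_ac x"
    using moduli_point_normalize[OF M3 assms(3)] by blast
  have "to_ac (det (C_mat x)) = to_ac (2 * w_c x ^ 2)"
    using det_C_mat[OF binary_form_map[OF F(1)]] det_to_ac[of "C_mat x"]
    by (simp add: F(2) wcoords.map_sel det_3 C_mat_to_ac)
  then have d: "det (C_mat x) \<noteq> 0" using c by (simp del: to_ac_mult)
  note ex = conic_parametrization_exists[OF d]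
  note model = model_from_parametrization[OF M3 assms(3) c]
  have 1: "\<exists>f g. is_model P f g \<and> defined_over_base f \<and> defined_over_base g"
    if "conic_points (C_mat x) \<noteq> {}"
    using ex model that defined_over_base_change by blast
  show ?thesis
    using 1 ex model conic_point_from_model[OF M3 assms(3) _ c] by blast
qed

end
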